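(* Let $G$ be a countable amenable group and let $(X,\mu,G)$ be a free measure-preserving action of $G$ on a probability space. Then $(X,\mu,G)$ has a multiorder as a measure-theoretic factor, i.e. there exist a multiorder $(\tilde{\mathcal O},\nu,G)$ on $G$ and a measure-theoretic factor map $\varphi:(X,\mu,G)\to(\tilde{\mathcal O},\nu,G)$.
   Context: A countable amenable group means an infinite countable discrete group $G$ in which there is a Følner sequence, i.e. a sequence of finite subsets $F_n\subset G$ with $\lim_n |F_n\cap gF_n|/|F_n|=1$ for every $g\in G$. A measure-preserving action is free if for $\mu$-almost every $x$ the stabilizer $\{g\in G: g(x)=x\}$ equals $\{e\}$, where $e$ is the unit of $G$. A measure-theoretic factor map is a measurable map defined $\mu$-almost everywhere, commuting with the actions $\mu$-almost everywhere and sending $\mu$ to $\nu$. A linear order $\prec$ on $G$ is of type $\mathbb Z$ if every order interval $[a,b]^{\prec}=\{a,b\}\cup\{g\in G: a\prec g\prec b\}$ ($a\prec b$) is finite and $G$ has no minimal or maximal element. The set $\tilde{\mathcal O}$ of all orders of type $\mathbb Z$ on $G$ is a Borel subset of $\{0,1\}^{G\times G}$ (relations identified with their indicator functions, product topology), with the inherited Borel sigma-algebra. $G$ acts on $\tilde{\mathcal O}$ by: $\prec'=g(\prec)$ where $a\prec' b\iff ag\prec bg$. A multiorder on $G$ is the measure-preserving action $(\tilde{\mathcal O},\nu,G)$, where $\nu$ is a $G$-invariant Borel probability measure on $\tilde{\mathcal O}$.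
   Formalization: The probability space is assumed standard (modulo null sets): over arbitrary probability spaces the claim fails, e.g. for Z^2 translating itself with the trivial sigma-algebra, where a factor map would give an invariant order of type Z on Z^2. *)

theory Defs
  imports "HOL-Probability.Probability" "HOL-Algebra.Group_Action"
begin

section \<open>Countable amenable groups\<close>

definition folner_sequence :: "('g, 'b) monoid_scheme \<Rightarrow> (nat \<Rightarrow> 'g set) \<Rightarrow> bool" where
  "folner_sequence G F \<longleftrightarrow>
     (\<forall>n. finite (F n) \<and> F n \<noteq> {} \<and> F n \<subseteq> carrier G) \<and>
     (\<forall>g\<in>carrier G.
        (\<lambda>n. real (card (F n \<inter> (g <#\<^bsub>G\<^esub> F n))) / real (card (F n))) \<longlonglongrightarrow> 1)"

definition countable_amenable_group :: "('g, 'b) monoid_scheme \<Rightarrow> bool" where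
  "countable_amenable_group G \<longleftrightarrow>
     group G \<and> countable (carrier G) \<and> infinite (carrier G) \<and> (\<exists>F. folner_sequence G F)"

section \<open>Standard probability spaces\<close>

definition borel_of :: "'a topology \<Rightarrow> 'a measure" where
  "borel_of T = sigma (topspace T) {U. openin T U}"

text \<open>Probability spaces are standard, as usual in ergodic theory. The definition is modulo null
  sets and covers both conventions: Borel probability measures on standard Borel spaces and
  their completions (Lebesgue spaces). Up to a null set, the underlying set carries a Polish
  topology, and the measurable sets lie between the Borel sets and their completion.\<close>

definition standard_prob_space :: "'x measure \<Rightarrow> bool" where
  "standard_prob_space M \<longleftrightarrow>
     prob_space M \<and>
     (\<exists>T. completely_metrizable_space T \<and> second_countable T \<and>
        topspace T \<in> sets M \<and> emeasure M (topspace T) = 1 \<and>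
        sets (borel_of T) \<subseteq> sets M \<and>
        (\<forall>A\<in>sets M. A \<subseteq> topspace T \<longrightarrow>
           (\<exists>B\<in>sets (borel_of T). \<exists>C\<in>sets (borel_of T).
              B \<subseteq> A \<and> A \<subseteq> C \<and> emeasure M (C - B) = 0)))"

section \<open>Measure-preserving actions and factor maps\<close>

text \<open>The library predicate \<^const>\<open>group_action\<close> requires each map \<open>\<alpha> g\<close> to be
  extensional, i.e. equal to \<^const>\<open>undefined\<close> outside the underlying set.\<close>

definition measure_preserving_action ::
    "('g, 'b) monoid_scheme \<Rightarrow> 'x measure \<Rightarrow> ('g \<Rightarrow> 'x \<Rightarrow> 'x) \<Rightarrow> bool" where
  "measure_preserving_action G M \<alpha> \<longleftrightarrow>
     prob_space M \<and> group_action G (space M) \<alpha> \<and>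
     (\<forall>g\<in>carrier G. \<alpha> g \<in> measurable M M \<and> distr M M (\<alpha> g) = M)"

definition free_action ::
    "('g, 'b) monoid_scheme \<Rightarrow> 'x measure \<Rightarrow> ('g \<Rightarrow> 'x \<Rightarrow> 'x) \<Rightarrow> bool" where
  "free_action G M \<alpha> \<longleftrightarrow> (AE x in M. stabilizer G \<alpha> x = {\<one>\<^bsub>G\<^esub>})"

text \<open>The map \<open>\<phi>\<close> is defined on the set \<open>D\<close> of full measure; its values elsewhere
  are irrelevant.\<close>

definition factor_map ::
    "('g, 'b) monoid_scheme \<Rightarrow> 'x measure \<Rightarrow> ('g \<Rightarrow> 'x \<Rightarrow> 'x) \<Rightarrow>
     'y measure \<Rightarrow> ('g \<Rightarrow> 'y \<Rightarrow> 'y) \<Rightarrow> ('x \<Rightarrow> 'y) \<Rightarrow> bool" where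
  "factor_map G M \<alpha> N \<beta> \<phi> \<longleftrightarrow>
     (\<exists>D\<in>sets M. emeasure M D = 1 \<and>
        \<phi> \<in> measurable (restrict_space M D) N \<and>
        distr (restrict_space M D) N \<phi> = N \<and>
        (AE x in M. \<forall>g\<in>carrier G. x \<in> D \<and> \<alpha> g x \<in> D \<and> \<phi> (\<alpha> g x) = \<beta> g (\<phi> x)))"

section \<open>Multiorders\<close>

definition Z_orders :: "('g, 'b) monoid_scheme \<Rightarrow> 'g rel set" where
  "Z_orders G =
     {r. r \<subseteq> carrier G \<times> carrier G \<and> strict_linear_order_on (carrier G) r \<and>
         (\<forall>a b. (a, b) \<in> r \<longrightarrow> finite ({a, b} \<union> {g. (a, g) \<in> r \<and> (g, b) \<in> r})) \<and>
         (\<forall>a\<in>carrier G. \<exists>b\<in>carrier G. (b, a) \<in> r) \<and>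
         (\<forall>a\<in>carrier G. \<exists>b\<in>carrier G. (a, b) \<in> r)}"

definition cantor_topology :: "('g, 'b) monoid_scheme \<Rightarrow> ('g \<times> 'g \<Rightarrow> bool) topology" where
  "cantor_topology G =
     product_topology (\<lambda>_. discrete_topology UNIV) (carrier G \<times> carrier G)"

text \<open>The Borel sigma-algebra of the product space, pulled back along the embedding of
  relations as indicator functions. (The measure of this \<^typ>\<open>'g rel measure\<close> plays no role.)\<close>

definition Z_orders_algebra :: "('g, 'b) monoid_scheme \<Rightarrow> 'g rel measure" where
  "Z_orders_algebra G =
     vimage_algebra (Z_orders G) (\<lambda>r. \<lambda>p \<in> carrier G \<times> carrier G. p \<in> r)
       (borel_of (cantor_topology G))"

definition order_action :: "('g, 'b) monoid_scheme \<Rightarrow> 'g \<Rightarrow> 'g rel \<Rightarrow> 'g rel" where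
  "order_action G g =
     (\<lambda>r \<in> Z_orders G.
        {(a, b) \<in> carrier G \<times> carrier G. (a \<otimes>\<^bsub>G\<^esub> g, b \<otimes>\<^bsub>G\<^esub> g) \<in> r})"

definition multiorder :: "('g, 'b) monoid_scheme \<Rightarrow> 'g rel measure \<Rightarrow> bool" where
  "multiorder G \<nu> \<longleftrightarrow>
     sets \<nu> = sets (Z_orders_algebra G) \<and> measure_preserving_action G \<nu> (order_action G)"

end

theory Submission
  imports Defs
begin

text \<open>A measurable rule that orders almost every orbit like the integers pulls back to a map
  \<open>x \<mapsto> r x\<close> into orders on \<open>G\<close>, where \<open>a\<close> precedes \<open>b\<close> iff \<open>a x\<close> precedes \<open>b x\<close>; this map is
  equivariant, and its distribution is the multiorder. To order the orbits one needs finite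
  measurable equivalence relations that increase to the orbit relation.

  For one finite \<open>S \<subseteq> G\<close>, a single finite set \<open>F\<close> with small \<open>S\<close>-boundary \<open>D\<close> suffices. For any
  set \<open>Z\<close> of positive measure, integrating the sizes of \<open>F x \<inter> Z\<close> and \<open>D x \<inter> Z\<close> shows that
  \<open>D x \<inter> Z\<close> is a small part of the nonempty piece \<open>F x \<inter> Z\<close> for a non-null set of \<open>x\<close>. Removing
  disjoint pieces of this kind again and again exhausts the space, and the edges \<open>(x, s x)\<close> that
  are cut start or end in the small boundaries. So finite relations approximate the orbit relation
  with errors \<open>2\<^sup>-\<^sup>k\<close>, and by Borel--Cantelli the intersections of the tails of this sequence of
  relations increase to the orbit relation almost everywhere.

  With an injective real function \<open>h\<close>, every class gets the minimum of \<open>h\<close> on it as a key. Two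
  points of an orbit are compared by their keys at the last level at which these differ. Intervals
  of this order are finite because they lie inside a class. There is no first or last point in
  almost every orbit, since the set of such points would have infinitely many disjoint translates
  of equal measure.\<close>

section \<open>Real functions separating points\<close>

text \<open>The function is \<open>h x = (\<Sum>k. (1/3)^k * indicator (U k) x)\<close>. In base 3
  the first differing digit, at position \<open>k\<close>, outweighs all later ones, whose sum is at
  most \<open>(1/3)^k / 2\<close>.\<close>

lemma separating_real_function:
  assumes U: "\<And>k::nat. U k \<in> sets M"
    and sep: "\<And>x y. x \<in> X \<Longrightarrow> y \<in> X \<Longrightarrow> x \<noteq> y \<Longrightarrow> \<exists>k. (x \<in> U k) \<noteq> (y \<in> U k)"
  obtains h :: "'x \<Rightarrow> real" where "h \<in> borel_measurable M" "inj_on h X"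
proof -
  define c :: "'x \<Rightarrow> nat \<Rightarrow> real" where "c x k = (1/3)^k * indicator (U k) x" for x k
  define h where "h x = (\<Sum>k. c x k)" for x
  have geo: "summable (\<lambda>k. (1/3::real)^k)"
    by (rule summable_geometric) simp
  have c_bounds: "0 \<le> c x k" "c x k \<le> (1/3)^k" for x k
    by (auto simp: c_def indicator_def)
  have smb: "summable (c x)" for x
    by (rule summable_comparison_test'[OF geo, of 0]) (auto simp: c_def indicator_def)
  have less: "h y < h x" if k: "x \<in> U k" "y \<notin> U k" and eq: "\<And>j. j < k \<Longrightarrow> (x \<in> U j) = (y \<in> U j)" for x y k
  proof -
    have split: "h z = (\<Sum>j. c z (j + Suc k)) + (\<Sum>j<Suc k. c z j)" for z
      unfolding h_def by (rule suminf_split_initial_segment[OF smb])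
    have tail: "(\<Sum>j. c y (j + Suc k)) \<le> (\<Sum>j. (1/3)^Suc k * (1/3)^j)"
    proof (rule suminf_le)
      show "c y (j + Suc k) \<le> (1/3)^Suc k * (1/3)^j" for j
        using c_bounds(2)[of y "j + Suc k"] by (simp add: power_add mult_ac)
      show "summable (\<lambda>j. c y (j + Suc k))"
        using smb by (rule summable_ignore_initial_segment)
      show "summable (\<lambda>j. (1/3)^Suc k * (1/3::real)^j)"
        using geo by (rule summable_mult)
    qed
    also have "\<dots> = (1/3)^Suc k * (\<Sum>j. (1/3::real)^j)"
      using geo by (rule suminf_mult)
    also have "\<dots> = (1/3)^k / 2"
      by (subst suminf_geometric) auto
    finally have tail_y: "(\<Sum>j. c y (j + Suc k)) \<le> (1/3)^k / 2" .
    have tail_x: "0 \<le> (\<Sum>j. c x (j + Suc k))"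
      by (rule suminf_nonneg[OF summable_ignore_initial_segment[OF smb]]) (rule c_bounds)
    have "(\<Sum>j<k. c x j) = (\<Sum>j<k. c y j)"
      using eq by (intro sum.cong) (auto simp: c_def indicator_def)
    moreover have "c x k = (1/3)^k" "c y k = 0"
      using k by (auto simp: c_def)
    moreover have "0 < (1/3::real)^k" by simp
    ultimately show ?thesis
      using tail_x tail_y unfolding split[of x] split[of y] sum.lessThan_Suc by linarith
  qed
  have "inj_on h X"
  proof (rule inj_onI, rule ccontr)
    fix x y assume xy: "x \<in> X" "y \<in> X" "h x = h y" "x \<noteq> y"
    define k where "k = (LEAST k. (x \<in> U k) \<noteq> (y \<in> U k))"
    have "(x \<in> U k) \<noteq> (y \<in> U k)"
      unfolding k_def using sep[OF xy(1,2,4)] by (rule LeastI_ex)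
    moreover have "(x \<in> U j) = (y \<in> U j)" if "j < k" for j
      using not_less_Least[OF that[unfolded k_def]] by blast
    ultimately show False
      using less[of x k y] less[of y k x] xy(3) by auto
  qed
  moreover have "h \<in> borel_measurable M"
    unfolding h_def c_def using U by measurable
  ultimately show thesis by (rule that[rotated])
qed

text \<open>Equal floors force a distance below 1, which fails once
  \<open>k * \<bar>a - b\<bar>\<close> exceeds 1. A fine enough grid thus separates finitely many
  real values.\<close>

lemma floor_scaled_distinct:
  fixes a b :: real
  assumes "a \<noteq> b"
  shows "eventually (\<lambda>k. \<lfloor>real k * a\<rfloor> \<noteq> \<lfloor>real k * b\<rfloor>) sequentially"
proof -
  obtain N :: nat where N: "1 < real N * \<bar>a - b\<bar>"
    using assms reals_Archimedean3[of "\<bar>a - b\<bar>"] by auto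
  have "\<lfloor>real k * a\<rfloor> \<noteq> \<lfloor>real k * b\<rfloor>" if "k \<ge> N" for k
  proof
    assume "\<lfloor>real k * a\<rfloor> = \<lfloor>real k * b\<rfloor>"
    then have "\<bar>real k * a - real k * b\<bar> < 1" by linarith
    moreover have "\<bar>real k * a - real k * b\<bar> = real k * \<bar>a - b\<bar>"
      by (simp add: abs_mult flip: right_diff_distrib)
    moreover have "real N * \<bar>a - b\<bar> \<le> real k * \<bar>a - b\<bar>"
      using that by (intro mult_right_mono) auto
    ultimately show False using N by linarith
  qed
  then show ?thesis by (auto simp: eventually_sequentially)
qed

section \<open>Free actions with separated points\<close>

locale pmp_action = prob_space M + group_action G "space M" \<alpha>
  for M :: "'x measure" and G :: "('g, 'b) monoid_scheme" (structure) and \<alpha> +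
  assumes countable_carrier: "countable (carrier G)"
    and measurable_act: "g \<in> carrier G \<Longrightarrow> \<alpha> g \<in> measurable M M"
    and distr_act: "g \<in> carrier G \<Longrightarrow> distr M M (\<alpha> g) = M"
begin

sublocale group G
  using group_hom group_hom.axioms(1) by blast

text \<open>\<open>D\<close> consists of the points whose whole orbit avoids the exceptional null
  set \<open>N\<close>. Only countably many null preimages of \<open>N\<close> are removed. This
  turns almost sure properties into properties valid everywhere on an invariant set.\<close>

lemma invariant_conull:
  assumes "AE x in M. P x"
  obtains D where "D \<in> sets M" "prob D = 1" "\<And>x. x \<in> D \<Longrightarrow> P x"
    "\<And>x g. x \<in> D \<Longrightarrow> g \<in> carrier G \<Longrightarrow> \<alpha> g x \<in> D"
proof -
  obtain N where N: "{x \<in> space M. \<not> P x} \<subseteq> N" "emeasure M N = 0" "N \<in> sets M"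
    using AE_E[OF assms] .
  define B where "B g = \<alpha> g -` N \<inter> space M" for g
  have B: "B g \<in> null_sets M" if g: "g \<in> carrier G" for g
  proof (rule null_setsI)
    show "B g \<in> sets M"
      unfolding B_def using measurable_sets[OF measurable_act[OF g] N(3)] .
    have "emeasure M (B g) = emeasure (distr M M (\<alpha> g)) N"
      unfolding B_def using g N by (simp add: emeasure_distr measurable_act)
    then show "emeasure M (B g) = 0"
      using g N by (simp add: distr_act)
  qed
  have null: "(\<Union>g\<in>carrier G. B g) \<in> null_sets M"
    using B countable_carrier by (rule null_sets_UN'[rotated])
  define D where "D = space M - (\<Union>g\<in>carrier G. B g)"
  have D_iff: "x \<in> D \<longleftrightarrow> x \<in> space M \<and> (\<forall>g\<in>carrier G. \<alpha> g x \<notin> N)" for x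
    by (auto simp: D_def B_def)
  show thesis
  proof (rule that)
    show "D \<in> sets M" using null by (auto simp: D_def)
    have "AE x in M. x \<in> D"
      using AE_not_in[OF null] AE_space by eventually_elim (auto simp: D_def)
    then show "prob D = 1"
      using \<open>D \<in> sets M\<close> by (simp add: prob_eq_1)
    show "P x" if "x \<in> D" for x
    proof -
      have "\<alpha> \<one> x = x" using that by (simp add: D_iff flip: id_eq_one)
      then have "x \<notin> N" "x \<in> space M" using that one_closed unfolding D_iff by metis+
      then show ?thesis using N(1) by blast
    qed
    show "\<alpha> g x \<in> D" if x: "x \<in> D" and g: "g \<in> carrier G" for x g
    proof -
      have "x \<in> space M" using x by (simp add: D_iff)
      then have "\<alpha> k (\<alpha> g x) = \<alpha> (k \<otimes> g) x" if "k \<in> carrier G" for k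
        using composition_rule[of x k g] that g by simp
      then have "\<forall>k\<in>carrier G. \<alpha> k (\<alpha> g x) \<notin> N"
        using x g by (simp add: D_iff)
      then show ?thesis
        using element_image[OF g \<open>x \<in> space M\<close> refl] by (simp add: D_iff)
    qed
  qed
qed

end

text \<open>Null sets are discarded once: on the invariant set \<open>X\<close> freeness holds at
  every point. The function \<open>h\<close> carries the information taken from the standard
  structure of the space.\<close>

locale free_pmp_action = pmp_action M G \<alpha>
  for M :: "'x measure" and G :: "('g, 'b) monoid_scheme" (structure) and \<alpha> +
  fixes X :: "'x set" and h :: "'x \<Rightarrow> real"
  assumes X_sets: "X \<in> sets M"
    and prob_X: "prob X = 1"
    and act_X: "x \<in> X \<Longrightarrow> g \<in> carrier G \<Longrightarrow> \<alpha> g x \<in> X"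
    and free: "x \<in> X \<Longrightarrow> g \<in> carrier G \<Longrightarrow> \<alpha> g x = x \<Longrightarrow> g = \<one>"
    and h_measurable: "h \<in> borel_measurable M"
    and inj_h: "inj_on h X"
begin

lemma X_space: "x \<in> X \<Longrightarrow> x \<in> space M"
  using sets.sets_into_space[OF X_sets] by blast

lemma act_one: "x \<in> X \<Longrightarrow> \<alpha> \<one> x = x"
  using X_space by (simp flip: id_eq_one)

lemma act_mult:
  "x \<in> X \<Longrightarrow> a \<in> carrier G \<Longrightarrow> b \<in> carrier G \<Longrightarrow> \<alpha> a (\<alpha> b x) = \<alpha> (a \<otimes> b) x"
  using X_space by (simp add: composition_rule)

lemma act_inv:
  assumes "x \<in> X" "g \<in> carrier G"
  shows "\<alpha> (inv g) (\<alpha> g x) = x" "\<alpha> g (\<alpha> (inv g) x) = x"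
  using assms by (simp_all add: act_mult act_one)

lemma act_inj:
  assumes x: "x \<in> X" and ab: "a \<in> carrier G" "b \<in> carrier G" and eq: "\<alpha> a x = \<alpha> b x"
  shows "a = b"
proof -
  have "\<alpha> (inv b \<otimes> a) x = x"
    using x ab eq by (simp add: act_inv flip: act_mult)
  then have "inv b \<otimes> a = \<one>"
    using x ab by (intro free) auto
  then show ?thesis
    using ab by (metis inv_closed inv_inv inv_equality)
qed

lemma sets_act:
  assumes "g \<in> carrier G" "A \<in> sets M"
  shows "{x \<in> X. \<alpha> g x \<in> A} \<in> sets M"
proof -
  have "{x \<in> X. \<alpha> g x \<in> A} = X \<inter> (\<alpha> g -` A \<inter> space M)"
    using X_space by blast
  then show ?thesis
    using measurable_sets[OF measurable_act] assms X_sets by auto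
qed

lemma emeasure_act:
  assumes "g \<in> carrier G" "A \<in> sets M"
  shows "emeasure M {x \<in> X. \<alpha> g x \<in> A} = emeasure M A"
proof -
  have "emeasure M A = emeasure (distr M M (\<alpha> g)) A"
    using assms by (simp add: distr_act)
  also have "\<dots> = emeasure M (\<alpha> g -` A \<inter> space M)"
    using assms by (intro emeasure_distr measurable_act)
  also have "\<dots> = emeasure M {x \<in> X. \<alpha> g x \<in> A}"
  proof (rule emeasure_eq_AE)
    have "AE x in M. x \<in> X"
      using prob_X X_sets by (simp add: prob_eq_1)
    then show "AE x in M. (x \<in> \<alpha> g -` A \<inter> space M) = (x \<in> {x \<in> X. \<alpha> g x \<in> A})"
      using X_space by auto
  qed (use assms sets_act measurable_sets[OF measurable_act] in auto)
  finally show ?thesis by simp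
qed

lemma prob_act:
  "g \<in> carrier G \<Longrightarrow> A \<in> sets M \<Longrightarrow> prob {x \<in> X. \<alpha> g x \<in> A} = prob A"
  by (simp add: measure_def emeasure_act)

text \<open>The first set is the preimage under \<open>\<alpha> g\<close> of the second, so
  invariance of the measure applies.\<close>

lemma prob_translate_inter:
  assumes "g \<in> carrier G" "A \<in> sets M" "B \<in> sets M" "B \<subseteq> X"
  shows "prob {c \<in> A \<inter> X. \<alpha> g c \<in> B} = prob {x \<in> B. \<alpha> (inv g) x \<in> A}"
proof -
  have "{c \<in> A \<inter> X. \<alpha> g c \<in> B} = {c \<in> X. \<alpha> g c \<in> {x \<in> B. \<alpha> (inv g) x \<in> A}}"
    using assms by (auto simp: act_inv)
  moreover have "{x \<in> B. \<alpha> (inv g) x \<in> A} = B \<inter> {x \<in> X. \<alpha> (inv g) x \<in> A}"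
    using assms by auto
  then have "{x \<in> B. \<alpha> (inv g) x \<in> A} \<in> sets M"
    using assms by (auto intro!: sets_act)
  ultimately show ?thesis
    using assms(1) by (simp only: prob_act)
qed

text \<open>By freeness this is the cardinality of \<open>K x \<inter> Z\<close> for
  \<open>x \<in> X\<close> and finite \<open>K \<subseteq> carrier G\<close>.\<close>

definition visits :: "'g set \<Rightarrow> 'x set \<Rightarrow> 'x \<Rightarrow> real" where
  "visits K Z x = (\<Sum>f\<in>K. indicator {y \<in> X. \<alpha> f y \<in> Z} x)"

lemma visits_nonneg: "0 \<le> visits K Z x"
  by (simp add: visits_def sum_nonneg)

lemma visits_mono: "D \<subseteq> F \<Longrightarrow> finite F \<Longrightarrow> visits D Z x \<le> visits F Z x"
  unfolding visits_def by (rule sum_mono2) auto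

lemma visits_pos: "finite K \<Longrightarrow> 0 < visits K Z x \<longleftrightarrow> x \<in> X \<and> (\<exists>f\<in>K. \<alpha> f x \<in> Z)"
  unfolding visits_def by (auto simp: sum_nonneg indicator_def less_le sum_nonneg_eq_0_iff)

lemma visits_measurable:
  assumes "K \<subseteq> carrier G" "Z \<in> sets M"
  shows "visits K Z \<in> borel_measurable M"
  unfolding visits_def[abs_def] using assms
  by (intro borel_measurable_sum borel_measurable_indicator sets_act) auto

lemma visits_integrable:
  assumes "K \<subseteq> carrier G" "Z \<in> sets M"
  shows "integrable M (visits K Z)"
  unfolding visits_def[abs_def] using assms
  by (intro Bochner_Integration.integrable_sum integrable_real_indicator sets_act)
    (auto simp: emeasure_eq_measure)

lemma integral_visits:
  assumes "K \<subseteq> carrier G" "Z \<in> sets M"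
  shows "(\<integral>x. visits K Z x \<partial>M) = card K * prob Z"
proof -
  have "(\<integral>x. visits K Z x \<partial>M) = (\<Sum>f\<in>K. prob {y \<in> X. \<alpha> f y \<in> Z})"
    unfolding visits_def using assms sets_act
    by (subst Bochner_Integration.integral_sum)
      (auto simp: emeasure_eq_measure subset_iff intro!: integrable_real_indicator sum.cong)
  also have "\<dots> = card K * prob Z"
    using assms by (simp add: prob_act subset_iff)
  finally show ?thesis .
qed

text \<open>With \<open>A\<close> as a set of base points, the right side adds the measures of the
  levels of the tower: level \<open>f\<close> consists of the points \<open>\<alpha> f c\<close> of
  \<open>Z\<close> with \<open>c \<in> A\<close>.\<close>

lemma integral_visits_on:
  assumes K: "K \<subseteq> carrier G" and A: "A \<in> sets M" "A \<subseteq> X" and Z: "Z \<in> sets M" "Z \<subseteq> X"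
  shows "(\<integral>x. indicator A x * visits K Z x \<partial>M) = (\<Sum>f\<in>K. prob {x \<in> Z. \<alpha> (inv f) x \<in> A})"
proof -
  have meas: "A \<inter> {y \<in> X. \<alpha> f y \<in> Z} \<in> sets M" if "f \<in> K" for f
    using that K A Z by (auto intro!: sets_act)
  have "(\<integral>x. indicator A x * visits K Z x \<partial>M)
      = (\<integral>x. (\<Sum>f\<in>K. indicator (A \<inter> {y \<in> X. \<alpha> f y \<in> Z}) x) \<partial>M)"
    unfolding visits_def by (simp add: sum_distrib_left indicator_inter_arith)
  also have "\<dots> = (\<Sum>f\<in>K. prob (A \<inter> {y \<in> X. \<alpha> f y \<in> Z}))"
    using meas by (subst Bochner_Integration.integral_sum)
      (auto simp: emeasure_eq_measure intro!: integrable_real_indicator sum.cong)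
  also have "\<dots> = (\<Sum>f\<in>K. prob {x \<in> Z. \<alpha> (inv f) x \<in> A})"
  proof (rule sum.cong)
    fix f assume "f \<in> K"
    moreover have "A \<inter> {y \<in> X. \<alpha> f y \<in> Z} = {c \<in> A \<inter> X. \<alpha> f c \<in> Z}" by blast
    ultimately show "prob (A \<inter> {y \<in> X. \<alpha> f y \<in> Z}) = prob {x \<in> Z. \<alpha> (inv f) x \<in> A}"
      using prob_translate_inter[of f A Z] K A Z by auto
  qed simp
  finally show ?thesis .
qed

text \<open>These are the admissible base points: the piece \<open>F x \<inter> Z\<close> is
  nonempty and at most the fraction \<open>\<epsilon>\<close> of it lies in the boundary
  \<open>D x\<close>.\<close>

definition good :: "'g set \<Rightarrow> 'g set \<Rightarrow> real \<Rightarrow> 'x set \<Rightarrow> 'x set" where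
  "good F D \<epsilon> Z = {x \<in> X. 0 < visits F Z x \<and> visits D Z x \<le> \<epsilon> * visits F Z x}"

lemma good_sets:
  assumes "F \<subseteq> carrier G" "D \<subseteq> F" "Z \<in> sets M"
  shows "good F D \<epsilon> Z \<in> sets M"
proof -
  have [measurable]: "visits F Z \<in> borel_measurable M" "visits D Z \<in> borel_measurable M" "X \<in> sets M"
    using assms visits_measurable X_sets by auto
  have "good F D \<epsilon> Z = {x \<in> space M. x \<in> X \<and> 0 < visits F Z x \<and> visits D Z x \<le> \<epsilon> * visits F Z x}"
    using X_space by (auto simp: good_def)
  also have "\<dots> \<in> sets M" by measurable
  finally show ?thesis .
qed

text \<open>The counts \<open>visits D Z\<close> and \<open>visits F Z\<close> have integrals \<open>card D * prob Z\<close> and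
  \<open>card F * prob Z\<close>, so if \<open>prob Z > 0\<close>, the first cannot exceed \<open>\<epsilon>\<close> times the second at
  almost every point whose translates by \<open>F\<close> meet \<open>Z\<close>.\<close>

lemma prob_eq_0_if_good_null:
  assumes F: "F \<subseteq> carrier G" "finite F" "F \<noteq> {}" and D: "D \<subseteq> F" "real (card D) \<le> \<epsilon> * real (card F)"
    and Z: "Z \<in> sets M" and null: "prob (good F D \<epsilon> Z) = 0"
  shows "prob Z = 0"
proof -
  let ?d = "\<lambda>x. visits D Z x - \<epsilon> * visits F Z x"
  have FD: "D \<subseteq> carrier G" using F D by blast
  have int: "integrable M ?d"
    using visits_integrable F FD Z by auto
  have "AE x in M. x \<notin> good F D \<epsilon> Z"
    using null good_sets[OF F(1) D(1) Z] by (intro AE_not_in null_setsI) (simp_all add: emeasure_eq_measure)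
  moreover have "AE x in M. x \<in> X"
    using prob_X X_sets by (simp add: prob_eq_1)
  \<comment> \<open>A point that \<open>F\<close> takes to \<open>Z\<close> but that is not good
    violates the inequality strictly; a point that \<open>F\<close> never takes to \<open>Z\<close>
    has no visit by \<open>D \<subseteq> F\<close> either.\<close>
  ultimately have vis: "AE x in M. visits F Z x = 0 \<and> visits D Z x = 0 \<or> 0 < ?d x"
  proof eventually_elim
    case (elim x)
    show ?case
      using elim visits_nonneg[of F Z x] visits_nonneg[of D Z x] visits_mono[OF D(1) F(2), of Z x]
      by (cases "visits F Z x = 0") (auto simp: good_def not_le)
  qed
  have nonneg: "AE x in M. 0 \<le> ?d x"
    using vis by eventually_elim auto
  have "(\<integral>x. ?d x \<partial>M) = (card D - \<epsilon> * card F) * prob Z"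
    using integral_visits visits_integrable F FD Z by (simp add: algebra_simps)
  also have "\<dots> \<le> 0"
    using D(2) by (intro mult_nonpos_nonneg) auto
  finally have "(\<integral>x. ?d x \<partial>M) = 0"
    using integral_nonneg_AE[OF nonneg] by linarith
  then have "AE x in M. ?d x = 0"
    using integral_nonneg_eq_0_iff_AE[OF int nonneg] by simp
  with vis have "AE x in M. visits F Z x = 0"
    by eventually_elim auto
  then have "(\<integral>x. visits F Z x \<partial>M) = 0"
    by (rule integral_eq_zero_AE)
  then show ?thesis
    using integral_visits[OF F(1) Z] F by simp
qed

end

section \<open>Partition into pieces of towers\<close>

context free_pmp_action
begin

text \<open>The labels \<open>u f\<close> prescribe the grid intervals of length \<open>1/k\<close>
  that contain the values of \<open>h\<close> along \<open>F x\<close>. If \<open>u\<close> is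
  injective on \<open>F\<close>, the translates of the cell by different elements of
  \<open>F\<close> are disjoint.\<close>

definition cell :: "'g set \<Rightarrow> nat \<Rightarrow> ('g \<Rightarrow> int) \<Rightarrow> 'x set" where
  "cell F k u = {x \<in> X. \<forall>f\<in>F. \<lfloor>real k * h (\<alpha> f x)\<rfloor> = u f}"

lemma cell_sets:
  assumes "finite F" "F \<subseteq> carrier G"
  shows "cell F k u \<in> sets M"
proof -
  have [measurable]: "(\<lambda>x. h (\<alpha> f x)) \<in> borel_measurable M" if "f \<in> F" for f
    using measurable_compose[OF measurable_act h_measurable] assms that by blast
  note [measurable] = X_sets
  have "cell F k u = {x \<in> space M. x \<in> X \<and> (\<forall>f\<in>F. \<lfloor>real k * h (\<alpha> f x)\<rfloor> = u f)}"
    using X_space by (auto simp: cell_def)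
  also have "\<dots> = {x \<in> space M. x \<in> X \<and>
      (\<forall>f\<in>F. of_int (u f) \<le> real k * h (\<alpha> f x) \<and> real k * h (\<alpha> f x) < of_int (u f) + 1)}"
    by (simp add: floor_eq_iff)
  also have "\<dots> \<in> sets M"
    using assms by measurable
  finally show ?thesis .
qed

lemma cell_disjoint:
  assumes "inj_on u F" "F \<subseteq> carrier G" "f \<in> F" "f' \<in> F" "c \<in> cell F k u" "c' \<in> cell F k u"
    and "\<alpha> f c = \<alpha> f' c'"
  shows "f = f'"
proof -
  have "u f = u f'" using assms by (auto simp: cell_def)
  then show ?thesis using assms by (auto dest: inj_onD)
qed

text \<open>Freeness and injectivity of \<open>h\<close> make the finitely many values
  \<open>h (\<alpha> f x)\<close> distinct, so some grid separates them.\<close>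

lemma cell_cover:
  assumes F: "finite F" "F \<subseteq> carrier G" and x: "x \<in> X"
  obtains k u where "u \<in> F \<rightarrow>\<^sub>E UNIV" "inj_on u F" "x \<in> cell F k u"
proof -
  have "eventually (\<lambda>k. f \<noteq> f' \<longrightarrow> \<lfloor>real k * h (\<alpha> f x)\<rfloor> \<noteq> \<lfloor>real k * h (\<alpha> f' x)\<rfloor>) sequentially"
    if "f \<in> F" "f' \<in> F" for f f'
  proof (cases "f = f'")
    case False
    have "\<alpha> f x \<noteq> \<alpha> f' x"
      using act_inj[OF x, of f f'] that False F by blast
    then have "h (\<alpha> f x) \<noteq> h (\<alpha> f' x)"
      using inj_onD[OF inj_h] act_X[OF x] that F by blast
    then show ?thesis
      using floor_scaled_distinct by (auto elim: eventually_mono)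
  qed simp
  then have "eventually (\<lambda>k. \<forall>f\<in>F. \<forall>f'\<in>F. f \<noteq> f' \<longrightarrow>
      \<lfloor>real k * h (\<alpha> f x)\<rfloor> \<noteq> \<lfloor>real k * h (\<alpha> f' x)\<rfloor>) sequentially"
    using F(1) by (intro eventually_ball_finite ballI) auto
  then obtain k where k: "\<And>f f'. f \<in> F \<Longrightarrow> f' \<in> F \<Longrightarrow> f \<noteq> f' \<Longrightarrow>
      \<lfloor>real k * h (\<alpha> f x)\<rfloor> \<noteq> \<lfloor>real k * h (\<alpha> f' x)\<rfloor>"
    unfolding eventually_sequentially by (meson order_refl)
  let ?u = "\<lambda>f\<in>F. \<lfloor>real k * h (\<alpha> f x)\<rfloor>"
  show thesis
  proof (rule that)
    show "inj_on ?u F" using k by (auto simp: inj_on_def)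
    show "x \<in> cell F k ?u" using x by (auto simp: cell_def)
  qed auto
qed

text \<open>Every point lies in infinitely many of the sets \<open>C n\<close>, so that a point which is good for
  the intersection of a decreasing sequence \<open>Y\<close> is selected at a stage \<open>n\<close> at which \<open>Y n\<close> already
  agrees with the intersection on the finite piece \<open>F x\<close>.\<close>

lemma recurrent_cells:
  assumes F: "finite F" "F \<subseteq> carrier G"
  obtains C :: "nat \<Rightarrow> 'x set" where
    "\<And>n. C n \<in> sets M" "\<And>n. C n \<subseteq> X"
    "\<And>n f f' c c'. f \<in> F \<Longrightarrow> f' \<in> F \<Longrightarrow> c \<in> C n \<Longrightarrow> c' \<in> C n \<Longrightarrow> \<alpha> f c = \<alpha> f' c' \<Longrightarrow> f = f'"
    "\<And>x N. x \<in> X \<Longrightarrow> \<exists>n\<ge>N. x \<in> C n"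
proof -
  define I where "I = (UNIV :: nat set) \<times> (F \<rightarrow>\<^sub>E (UNIV :: int set))"
  have I: "countable I" "I \<noteq> {}"
    unfolding I_def using F by (auto intro!: countable_SIGMA countable_PiE simp: PiE_eq_empty_iff)
  \<comment> \<open>Only the first component of the decoded pair selects a cell. The second is a
    counter that makes every cell recur at arbitrarily late stages.\<close>
  define C where "C n = (case from_nat_into I (fst (prod_decode n)) of (k, u) \<Rightarrow>
      if inj_on u F then cell F k u else {})" for n
  show thesis
  proof (rule that)
    show "C n \<in> sets M" for n
      using cell_sets[OF F] by (auto simp: C_def split: prod.split)
    show "C n \<subseteq> X" for n
      by (auto simp: C_def cell_def split: prod.splits if_splits)
    show "f = f'" if "f \<in> F" "f' \<in> F" "c \<in> C n" "c' \<in> C n" "\<alpha> f c = \<alpha> f' c'" for n f f' c c'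
      using that cell_disjoint[OF _ F(2) that(1,2) _ _ that(5)]
      by (auto simp: C_def split: prod.splits if_splits)
    show "\<exists>n\<ge>N. x \<in> C n" if x: "x \<in> X" for x N
    proof -
      obtain k u where u: "u \<in> F \<rightarrow>\<^sub>E UNIV" "inj_on u F" "x \<in> cell F k u"
        using cell_cover[OF F x] by blast
      have "(k, u) \<in> I" using u(1) by (simp add: I_def)
      then obtain i where "from_nat_into I i = (k, u)"
        using from_nat_into_to_nat_on[OF I(1)] by blast
      then have "x \<in> C (prod_encode (i, N))"
        using u by (simp add: C_def)
      then show ?thesis using le_prod_encode_2 by blast
    qed
  qed
qed

text \<open>Greedy removal: at stage \<open>n\<close> the points of \<open>C n\<close> that are good
  for what is still left become bases, and the pieces over them are taken away.\<close>

primrec remainder :: "'g set \<Rightarrow> 'g set \<Rightarrow> real \<Rightarrow> (nat \<Rightarrow> 'x set) \<Rightarrow> nat \<Rightarrow> 'x set" where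
  "remainder F D \<epsilon> C 0 = X"
| "remainder F D \<epsilon> C (Suc n) = remainder F D \<epsilon> C n -
     (\<Union>f\<in>F. {x \<in> X. \<alpha> (inv f) x \<in> C n \<inter> good F D \<epsilon> (remainder F D \<epsilon> C n)})"

text \<open>The intersection of all \<open>Y n\<close> has no good points, hence is null. The parts
  removed at different stages are disjoint and each has boundary fraction at most
  \<open>\<epsilon>\<close>, so the boundaries add up to at most \<open>\<epsilon>\<close>.\<close>

lemma tower_partition:
  assumes F: "finite F" "F \<noteq> {}" "F \<subseteq> carrier G"
    and D: "D \<subseteq> F" "real (card D) \<le> \<epsilon> * real (card F)" and "0 \<le> \<epsilon>"
  obtains A Y :: "nat \<Rightarrow> 'x set" where
    "\<And>n. A n \<in> sets M" "\<And>n. Y n \<in> sets M" "Y 0 = X"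
    "\<And>n. Y (Suc n) = Y n - (\<Union>f\<in>F. {x \<in> Y n. \<alpha> (inv f) x \<in> A n})"
    "\<And>n f f' c c'. f \<in> F \<Longrightarrow> f' \<in> F \<Longrightarrow> c \<in> A n \<Longrightarrow> c' \<in> A n \<Longrightarrow> \<alpha> f c = \<alpha> f' c' \<Longrightarrow> f = f'"
    "prob (\<Inter>n. Y n) = 0"
    "prob (\<Union>n. \<Union>f\<in>D. {x \<in> Y n. \<alpha> (inv f) x \<in> A n}) \<le> \<epsilon>"
proof -
  obtain C :: "nat \<Rightarrow> 'x set" where C_sets: "\<And>n. C n \<in> sets M" and C_X: "\<And>n. C n \<subseteq> X"
    and C_disj: "\<And>n f f' c c'. f \<in> F \<Longrightarrow> f' \<in> F \<Longrightarrow> c \<in> C n \<Longrightarrow> c' \<in> C n \<Longrightarrow>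
        \<alpha> f c = \<alpha> f' c' \<Longrightarrow> f = f'"
    and C_rec: "\<And>x N. x \<in> X \<Longrightarrow> \<exists>n\<ge>N. x \<in> C n"
    by (rule recurrent_cells[OF F(1,3)]) blast
  define Y where "Y = remainder F D \<epsilon> C"
  define A where "A n = C n \<inter> good F D \<epsilon> (Y n)" for n
  have F_closed: "f \<in> F \<Longrightarrow> f \<in> carrier G" for f using F(3) by blast
  have Y0: "Y 0 = X" by (simp add: Y_def)
  have YS': "Y (Suc n) = Y n - (\<Union>f\<in>F. {x \<in> X. \<alpha> (inv f) x \<in> A n})" for n
    by (simp add: Y_def A_def)
  have Y_X: "Y n \<subseteq> X" for n
    by (induction n) (auto simp: Y0 YS')
  have YS: "Y (Suc n) = Y n - (\<Union>f\<in>F. {x \<in> Y n. \<alpha> (inv f) x \<in> A n})" for n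
    using Y_X[of n] unfolding YS' by blast
  have Y_A_sets: "Y n \<in> sets M \<and> A n \<in> sets M" for n
  proof (induction n)
    case 0
    show ?case
      using X_sets C_sets good_sets[OF F(3) D(1)] by (simp add: Y0 A_def)
  next
    case (Suc n)
    then have "Y (Suc n) \<in> sets M"
      using F unfolding YS' by (auto intro!: sets.Diff sets.finite_UN sets_act)
    then show ?case
      using C_sets good_sets[OF F(3) D(1)] by (simp add: A_def)
  qed
  then have Y_sets: "Y n \<in> sets M" and A_sets: "A n \<in> sets M" for n by auto
  have A_X: "A n \<subseteq> X" for n using C_X by (auto simp: A_def)
  have A_disj: "f = f'" if "f \<in> F" "f' \<in> F" "c \<in> A n" "c' \<in> A n" "\<alpha> f c = \<alpha> f' c'" for n f f' c c'
    using that C_disj by (auto simp: A_def)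
  have decY: "Y n \<subseteq> Y m" if "m \<le> n" for m n
    by (rule lift_Suc_antimono_le[OF _ that]) (auto simp: YS')
  define tower where "tower n f = {x \<in> Y n. \<alpha> (inv f) x \<in> A n}" for n f
  have tower_sets: "tower n f \<in> sets M" if "f \<in> F" for n f
  proof -
    have "tower n f = Y n \<inter> {x \<in> X. \<alpha> (inv f) x \<in> A n}"
      using Y_X by (auto simp: tower_def)
    then show ?thesis
      using sets_act[of "inv f" "A n"] that F_closed Y_sets A_sets by auto
  qed

  define Z where "Z = (\<Inter>n. Y n)"
  have Z_sets: "Z \<in> sets M" unfolding Z_def using Y_sets by auto
  have Z_X: "Z \<subseteq> X" using Y0 by (auto simp: Z_def)
  have "good F D \<epsilon> Z = {}"
  proof (rule ccontr)
    assume "good F D \<epsilon> Z \<noteq> {}"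
    then obtain x where x: "x \<in> good F D \<epsilon> Z" by blast
    then have xX: "x \<in> X" by (simp add: good_def)
    have "eventually (\<lambda>n. \<alpha> f x \<in> Y n \<longleftrightarrow> \<alpha> f x \<in> Z) sequentially" for f
    proof (cases "\<alpha> f x \<in> Z")
      case True
      then show ?thesis by (auto simp: Z_def)
    next
      case False
      then obtain N where "\<alpha> f x \<notin> Y N" by (auto simp: Z_def)
      then have "\<alpha> f x \<notin> Y n" if "n \<ge> N" for n using decY[OF that] by blast
      then show ?thesis using False by (auto simp: eventually_sequentially)
    qed
    then have "eventually (\<lambda>n. \<forall>f\<in>F. \<alpha> f x \<in> Y n \<longleftrightarrow> \<alpha> f x \<in> Z) sequentially"
      using F(1) by (intro eventually_ball_finite) auto
    then obtain N where N: "\<And>n f. n \<ge> N \<Longrightarrow> f \<in> F \<Longrightarrow> \<alpha> f x \<in> Y n \<longleftrightarrow> \<alpha> f x \<in> Z"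
      by (auto simp: eventually_sequentially)
    obtain n where n: "n \<ge> N" "x \<in> C n" using C_rec[OF xX] by blast
    have "visits K (Y n) x = visits K Z x" if "K \<subseteq> F" for K
      unfolding visits_def using N[OF n(1)] that by (intro sum.cong) (auto simp: indicator_def)
    then have "x \<in> A n"
      using x n D(1) by (simp add: A_def good_def)
    \<comment> \<open>Goodness puts a point of \<open>Z\<close> into the piece over
      \<open>x\<close>. Since \<open>x\<close> is a base at stage \<open>n\<close>, that point is
      removed, although points of \<open>Z\<close> are never removed.\<close>
    obtain f where f: "f \<in> F" "\<alpha> f x \<in> Z"
      using x visits_pos[OF F(1)] by (auto simp: good_def)
    then have "\<alpha> f x \<in> Y (Suc n)" by (auto simp: Z_def)
    moreover have "\<alpha> (inv f) (\<alpha> f x) \<in> A n"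
      using \<open>x \<in> A n\<close> act_inv xX F_closed f by simp
    ultimately show False
      using f(1) act_X[OF xX] F_closed unfolding YS' by blast
  qed
  then have Z_null: "prob Z = 0"
    using prob_eq_0_if_good_null[OF F(3,1,2) D Z_sets] by simp

  define Q where "Q n = (\<Union>f\<in>D. tower n f)" for n
  define R where "R n = Y n - Y (Suc n)" for n
  have R_tower: "R n = (\<Union>f\<in>F. tower n f)" for n
    by (auto simp: R_def YS tower_def)
  have Q_sets: "Q n \<in> sets M" for n
    unfolding Q_def using D(1) F(1) tower_sets by (auto intro!: sets.finite_UN intro: finite_subset)
  have R_sets: "R n \<in> sets M" for n
    unfolding R_def using Y_sets by auto
  have tower_inj: "disjoint_family_on (tower n) F" for n
  proof -
    have False if "f \<in> F" "f' \<in> F" "f \<noteq> f'" "x \<in> tower n f" "x \<in> tower n f'" for f f' x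
    proof -
      have "x \<in> X" "\<alpha> (inv f) x \<in> A n" "\<alpha> (inv f') x \<in> A n"
        using that Y_X by (auto simp: tower_def)
      then show False
        using A_disj[OF that(1,2), of "\<alpha> (inv f) x" n "\<alpha> (inv f') x"] that act_inv F_closed by auto
    qed
    then show ?thesis by (auto simp: disjoint_family_on_def)
  qed
  \<comment> \<open>The inequality defining good points is integrated over the bases
    \<open>A n\<close>, which turns counts into measures of tower levels. Subadditivity suffices on
    the side of \<open>D\<close>; for \<open>F\<close> disjointness of the levels gives exactly
    \<open>prob (R n)\<close>.\<close>
  have stage: "prob (Q n) \<le> \<epsilon> * prob (R n)" for n
  proof -
    have DG: "D \<subseteq> carrier G" using D F by blast
    have "prob (Q n) \<le> (\<Sum>f\<in>D. prob (tower n f))"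
      unfolding Q_def using D(1) F(1) tower_sets
      by (intro finite_measure_subadditive_finite) (auto intro: finite_subset)
    also have "\<dots> = (\<integral>x. indicator (A n) x * visits D (Y n) x \<partial>M)"
      unfolding tower_def by (rule integral_visits_on[OF DG A_sets A_X Y_sets Y_X, symmetric])
    also have "\<dots> \<le> (\<integral>x. \<epsilon> * (indicator (A n) x * visits F (Y n) x) \<partial>M)"
    proof (rule integral_mono)
      show "integrable M (\<lambda>x. indicator (A n) x * visits D (Y n) x)"
        using integrable_mult_indicator[OF A_sets visits_integrable[OF DG Y_sets]] by simp
      show "integrable M (\<lambda>x. \<epsilon> * (indicator (A n) x * visits F (Y n) x))"
        using integrable_mult_indicator[OF A_sets visits_integrable[OF F(3) Y_sets]] by simp
      show "indicator (A n) x * visits D (Y n) x \<le> \<epsilon> * (indicator (A n) x * visits F (Y n) x)" for x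
        by (auto simp: indicator_def A_def good_def)
    qed
    also have "\<dots> = \<epsilon> * (\<Sum>f\<in>F. prob (tower n f))"
      unfolding tower_def by (simp add: integral_visits_on[OF F(3) A_sets A_X Y_sets Y_X])
    also have "(\<Sum>f\<in>F. prob (tower n f)) = prob (R n)"
      unfolding R_tower using F(1) tower_sets tower_inj
      by (intro finite_measure_finite_Union[symmetric]) auto
    finally show ?thesis .
  qed
  have "R m \<inter> R n = {}" if "m < n" for m n
    using decY[of "Suc m" n] that by (auto simp: R_def)
  then have "disjoint_family R"
    unfolding disjoint_family_on_def by (metis Int_commute nat_neq_iff)
  have "emeasure M (\<Union>n. Q n) \<le> (\<Sum>n. emeasure M (Q n))"
    using Q_sets by (intro emeasure_subadditive_countably) auto
  also have "\<dots> \<le> (\<Sum>n. ennreal \<epsilon> * emeasure M (R n))"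
    using stage \<open>0 \<le> \<epsilon>\<close> by (intro suminf_le) (auto simp: emeasure_eq_measure ennreal_mult[symmetric])
  also have "\<dots> = ennreal \<epsilon> * emeasure M (\<Union>n. R n)"
    by (subst suminf_emeasure[symmetric]) (use R_sets \<open>disjoint_family R\<close> in auto)
  also have "\<dots> \<le> ennreal \<epsilon> * 1"
    by (intro mult_left_mono emeasure_le_1) auto
  finally have "prob (\<Union>n. Q n) \<le> \<epsilon>"
    using \<open>0 \<le> \<epsilon>\<close> by (simp add: emeasure_eq_measure)
  then have Q_bound: "prob (\<Union>n. \<Union>f\<in>D. {x \<in> Y n. \<alpha> (inv f) x \<in> A n}) \<le> \<epsilon>"
    by (simp add: Q_def tower_def)
  show thesis
  proof (rule that)
    show "A n \<in> sets M" "Y n \<in> sets M" for n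
      by (fact A_sets Y_sets)+
    show "Y 0 = X" by (fact Y0)
    show "Y (Suc n) = Y n - (\<Union>f\<in>F. {x \<in> Y n. \<alpha> (inv f) x \<in> A n})" for n
      by (fact YS)
    show "f = f'" if "f \<in> F" "f' \<in> F" "c \<in> A n" "c' \<in> A n" "\<alpha> f c = \<alpha> f' c'" for n f f' c c'
      using that by (rule A_disj)
    show "prob (\<Inter>n. Y n) = 0"
      using Z_null by (simp add: Z_def)
    show "prob (\<Union>n. \<Union>f\<in>D. {x \<in> Y n. \<alpha> (inv f) x \<in> A n}) \<le> \<epsilon>"
      by (fact Q_bound)
  qed
qed

end

section \<open>Approximate equivariance from Folner sets\<close>

text \<open>A late Folner set loses at most the fraction \<open>\<delta>\<close> under each
  \<open>s\<close>, and a union bound over \<open>S\<close> gives the claim since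
  \<open>card S * \<delta> \<le> \<epsilon>\<close>.\<close>

lemma (in group) folner_small_boundary:
  assumes folner: "folner_sequence G F" and S: "finite S" "S \<subseteq> carrier G" and "0 < (\<epsilon>::real)"
  obtains K where "finite K" "K \<noteq> {}" "K \<subseteq> carrier G"
    "real (card {f \<in> K. \<exists>s\<in>S. s \<otimes> f \<notin> K}) \<le> \<epsilon> * real (card K)"
proof -
  have F: "finite (F n)" "F n \<noteq> {}" "F n \<subseteq> carrier G" for n
    using folner by (auto simp: folner_sequence_def)
  define \<delta> where "\<delta> = \<epsilon> / (real (card S) + 1)"
  have "0 < \<delta>" using \<open>0 < \<epsilon>\<close> by (simp add: \<delta>_def)
  have "eventually (\<lambda>n. 1 - \<delta> < real (card (F n \<inter> (s <# F n))) / real (card (F n))) sequentially"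
    if "s \<in> S" for s
    using folner that S \<open>0 < \<delta>\<close> unfolding folner_sequence_def
    by (intro order_tendstoD(1)[of _ 1]) auto
  then have "eventually (\<lambda>n. \<forall>s\<in>S. 1 - \<delta> < real (card (F n \<inter> (s <# F n))) / real (card (F n))) sequentially"
    using S(1) by (intro eventually_ball_finite) auto
  then obtain n where n: "\<And>s. s \<in> S \<Longrightarrow> 1 - \<delta> < real (card (F n \<inter> (s <# F n))) / real (card (F n))"
    by (auto simp: eventually_sequentially)
  have pos: "0 < real (card (F n))"
    using F[of n] by (simp add: card_gt_0_iff)
  have one: "real (card {f \<in> F n. s \<otimes> f \<notin> F n}) \<le> \<delta> * real (card (F n))" if s: "s \<in> S" for s
  proof -
    have sG: "s \<in> carrier G" using s S by blast
    \<comment> \<open>Left multiplication by \<open>s\<close> matches the elements that stay in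
      \<open>F n\<close> with the intersection in the Folner condition.\<close>
    have "F n \<inter> (s <# F n) = (\<lambda>f. s \<otimes> f) ` {f \<in> F n. s \<otimes> f \<in> F n}"
      by (auto simp: l_coset_def)
    moreover have "inj_on (\<lambda>f. s \<otimes> f) {f \<in> F n. s \<otimes> f \<in> F n}"
      using F(3)[of n] sG by (auto simp: inj_on_def subset_iff)
    ultimately have "card (F n \<inter> (s <# F n)) = card {f \<in> F n. s \<otimes> f \<in> F n}"
      by (simp add: card_image)
    moreover have "card (F n) = card {f \<in> F n. s \<otimes> f \<in> F n} + card {f \<in> F n. s \<otimes> f \<notin> F n}"
      using F(1)[of n] by (subst card_Un_disjoint[symmetric]) (auto intro: arg_cong[of _ _ card])
    moreover have "(1 - \<delta>) * real (card (F n)) < real (card (F n \<inter> (s <# F n)))"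
      using n[OF s] pos by (simp add: pos_less_divide_eq)
    ultimately show ?thesis
      by (simp add: algebra_simps)
  qed
  have "card {f \<in> F n. \<exists>s\<in>S. s \<otimes> f \<notin> F n} = card (\<Union>s\<in>S. {f \<in> F n. s \<otimes> f \<notin> F n})"
    by (rule arg_cong[of _ _ card]) blast
  also have "\<dots> \<le> (\<Sum>s\<in>S. card {f \<in> F n. s \<otimes> f \<notin> F n})"
    by (rule card_UN_le[OF S(1)])
  finally have "real (card {f \<in> F n. \<exists>s\<in>S. s \<otimes> f \<notin> F n})
      \<le> (\<Sum>s\<in>S. real (card {f \<in> F n. s \<otimes> f \<notin> F n}))"
    by (simp flip: of_nat_sum)
  also have "\<dots> \<le> (\<Sum>s\<in>S. \<delta> * real (card (F n)))"
    by (rule sum_mono) (rule one)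
  also have "\<dots> = (real (card S) * \<delta>) * real (card (F n))"
    by simp
  also have "\<dots> \<le> \<epsilon> * real (card (F n))"
    using \<open>0 < \<epsilon>\<close> by (intro mult_right_mono) (auto simp: \<delta>_def field_simps)
  finally show thesis
    using that[of "F n"] F by blast
qed

context free_pmp_action
begin

text \<open>The label \<open>t x \<in> F\<close> is the position of \<open>x = \<alpha> (t x) c\<close> in its tower \<open>F c\<close>, and
  \<open>t (\<alpha> s x) = s \<otimes> t x\<close> says that \<open>x\<close> and \<open>\<alpha> s x\<close> have the same base point \<open>c\<close>. This can fail
  only if one of them is a boundary point of its piece, namely of the piece removed first.\<close>

lemma equivariant_approximation:
  assumes folner: "folner_sequence G Fn" and S: "finite S" "S \<subseteq> carrier G" and "0 < \<delta>"
  obtains t :: "'x \<Rightarrow> 'g" and B where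
    "\<And>x. x \<in> X \<Longrightarrow> t x \<in> carrier G" "finite (t ` X)" "\<And>f. {x \<in> X. t x = f} \<in> sets M"
    "B \<in> sets M" "prob B \<le> \<delta>"
    "\<And>x s. x \<in> X \<Longrightarrow> x \<notin> B \<Longrightarrow> s \<in> S \<Longrightarrow> t (\<alpha> s x) = s \<otimes> t x"
proof -
  \<comment> \<open>Inverses are included because the piece of \<open>\<alpha> s x\<close> may be
    removed before that of \<open>x\<close>, and then the step is taken backwards.\<close>
  define S' where "S' = S \<union> (\<lambda>s. inv s) ` S"
  define \<epsilon> where "\<epsilon> = \<delta> / (real (card S) + 1)"
  have "0 < \<epsilon>" using \<open>0 < \<delta>\<close> by (simp add: \<epsilon>_def)
  have S': "finite S'" "S' \<subseteq> carrier G" using S by (auto simp: S'_def)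
  obtain F where F: "finite F" "F \<noteq> {}" "F \<subseteq> carrier G"
    and F_bound: "real (card {f \<in> F. \<exists>s\<in>S'. s \<otimes> f \<notin> F}) \<le> \<epsilon> * real (card F)"
    using folner_small_boundary[OF folner S' \<open>0 < \<epsilon>\<close>] by blast
  define D where "D = {f \<in> F. \<exists>s\<in>S'. s \<otimes> f \<notin> F}"
  have D: "D \<subseteq> F" "real (card D) \<le> \<epsilon> * real (card F)"
    using F_bound by (auto simp: D_def)
  obtain A Y :: "nat \<Rightarrow> 'x set" where A_sets: "\<And>n. A n \<in> sets M"
    and Y_sets: "\<And>n. Y n \<in> sets M" and Y0: "Y 0 = X"
    and YS: "\<And>n. Y (Suc n) = Y n - (\<Union>f\<in>F. {x \<in> Y n. \<alpha> (inv f) x \<in> A n})"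
    and A_disj: "\<And>n f f' c c'. f \<in> F \<Longrightarrow> f' \<in> F \<Longrightarrow> c \<in> A n \<Longrightarrow> c' \<in> A n \<Longrightarrow> \<alpha> f c = \<alpha> f' c' \<Longrightarrow> f = f'"
    and Z_null: "prob (\<Inter>n. Y n) = 0"
    and Q_bound: "prob (\<Union>n. \<Union>f\<in>D. {x \<in> Y n. \<alpha> (inv f) x \<in> A n}) \<le> \<epsilon>"
    by (rule tower_partition[OF F D less_imp_le[OF \<open>0 < \<epsilon>\<close>]]) blast
  have decY: "Y n \<subseteq> Y m" if "m \<le> n" for m n
    by (rule lift_Suc_antimono_le[OF _ that]) (auto simp: YS)
  have Y_X: "Y n \<subseteq> X" for n
    using decY[of 0 n] Y0 by simp
  have FG: "f \<in> F \<Longrightarrow> f \<in> carrier G" for f using F(3) by blast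
  define tower where "tower x f n \<longleftrightarrow> f \<in> F \<and> x \<in> Y n \<and> \<alpha> (inv f) x \<in> A n" for x f n
  have tower_sets: "{x \<in> X. tower x f n} \<in> sets M" for f n
  proof (cases "f \<in> F")
    case True
    have "{x \<in> X. tower x f n} = Y n \<inter> {x \<in> X. \<alpha> (inv f) x \<in> A n}"
      using Y_X True by (auto simp: tower_def)
    then show ?thesis
      using sets_act[of "inv f" "A n"] True FG Y_sets A_sets by auto
  qed (simp add: tower_def)
  \<comment> \<open>A tower at stage \<open>n\<close> takes \<open>x\<close> out of
    \<open>Y (Suc n)\<close>, which determines the stage; within a stage the levels are
    disjoint.\<close>
  have tower_unique: "f = f'" if "tower x f n" "tower x f' n'" for x f f' n n'
  proof -
    have leave: "x \<notin> Y (Suc n)" if "tower x f n" for f n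
      using that by (auto simp: tower_def YS)
    have "n = n'"
    proof (rule linorder_cases[of n n'])
      assume "n < n'"
      then show ?thesis using leave[OF that(1)] decY[of "Suc n" n'] that(2) by (auto simp: tower_def)
    next
      assume "n' < n"
      then show ?thesis using leave[OF that(2)] decY[of "Suc n'" n] that(1) by (auto simp: tower_def)
    qed
    moreover have "x \<in> X" using that Y_X by (auto simp: tower_def)
    ultimately show ?thesis
      using that A_disj[of f f' "\<alpha> (inv f) x" n "\<alpha> (inv f') x"] by (auto simp: tower_def act_inv FG)
  qed
  have tower_ex: "\<exists>f n. tower x f n" if x: "x \<in> X" "x \<notin> (\<Inter>n. Y n)" for x
  proof -
    obtain m where "x \<notin> Y m" using x by blast
    then obtain n where "x \<in> Y n" "x \<notin> Y (Suc n)"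
      using x Y0 by (induction m) auto
    then show ?thesis by (auto simp: tower_def YS)
  qed
  have transport: "tower (\<alpha> s x) (s \<otimes> f) n"
    if "tower x f n" "f \<notin> D" "s \<in> S'" "\<alpha> s x \<in> Y n" for x f n s
  proof -
    have f: "f \<in> F" "x \<in> Y n" "\<alpha> (inv f) x \<in> A n" using that by (auto simp: tower_def)
    have sf: "s \<otimes> f \<in> F" using f that by (auto simp: D_def)
    have sG: "s \<in> carrier G" using that S' by blast
    have xX: "x \<in> X" using f Y_X by blast
    have "\<alpha> (inv (s \<otimes> f)) (\<alpha> s x) = \<alpha> (inv f) (\<alpha> (inv s) (\<alpha> s x))"
      using f xX sG FG by (simp add: inv_mult_group act_mult act_X m_assoc)
    also have "\<dots> = \<alpha> (inv f) x" using xX sG by (simp add: act_inv)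
    finally show ?thesis using that sf f by (simp add: tower_def)
  qed

  obtain f0 where "f0 \<in> F" using F by blast
  \<comment> \<open>The default \<open>f0\<close> at points in no tower keeps all values in the
    finite set \<open>F\<close>.\<close>
  define t where "t x = (if \<exists>f n. tower x f n then THE f. \<exists>n. tower x f n else f0)" for x
  have t_eq: "t x = f" if "tower x f n" for x f n
  proof -
    have "(THE f. \<exists>n. tower x f n) = f"
      using that tower_unique by blast
    then show ?thesis using that by (auto simp: t_def)
  qed
  have t_F: "t x \<in> F" for x
  proof (cases "\<exists>f n. tower x f n")
    case True
    then obtain f n where "tower x f n" by blast
    then show ?thesis using t_eq by (auto simp: tower_def)
  qed (simp add: t_def \<open>f0 \<in> F\<close>)

  \<comment> \<open>The bad points: those never removed, and those on a boundary level.\<close>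
  define N where "N = (\<Inter>n. Y n) \<union> (\<Union>n. \<Union>f\<in>D. {x \<in> X. tower x f n})"
  have "finite D" using D F by (auto intro: finite_subset)
  have N_sets: "N \<in> sets M"
    unfolding N_def using Y_sets tower_sets \<open>finite D\<close> by (intro sets.Un sets.countable_INT' sets.countable_UN sets.finite_UN) auto
  have "prob N \<le> prob (\<Inter>n. Y n) + prob (\<Union>n. \<Union>f\<in>D. {x \<in> X. tower x f n})"
    unfolding N_def using Y_sets tower_sets \<open>finite D\<close>
    by (intro measure_Un_le sets.countable_INT' sets.countable_UN sets.finite_UN) auto
  also have "(\<Union>n. \<Union>f\<in>D. {x \<in> X. tower x f n}) = (\<Union>n. \<Union>f\<in>D. {x \<in> Y n. \<alpha> (inv f) x \<in> A n})"
    using subsetD[OF D(1)] subsetD[OF Y_X] by (intro SUP_cong refl) (auto simp: tower_def)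
  finally have N_bound: "prob N \<le> \<epsilon>" using Z_null Q_bound by simp
  \<comment> \<open>Both ends of an edge have to avoid \<open>N\<close>. This takes
    \<open>card S + 1\<close> sets of measure at most \<open>\<epsilon>\<close>, which explains the
    choice of \<open>\<epsilon>\<close>.\<close>
  define B where "B = N \<union> (\<Union>s\<in>S. {x \<in> X. \<alpha> s x \<in> N})"
  have SN_sets: "{x \<in> X. \<alpha> s x \<in> N} \<in> sets M" if "s \<in> S" for s
    using that S N_sets by (intro sets_act) auto
  have B_sets: "B \<in> sets M"
    unfolding B_def using N_sets SN_sets S by (intro sets.Un sets.finite_UN) auto
  have "prob B \<le> prob N + prob (\<Union>s\<in>S. {x \<in> X. \<alpha> s x \<in> N})"
    unfolding B_def using N_sets SN_sets S by (intro measure_Un_le sets.finite_UN) auto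
  also have "prob (\<Union>s\<in>S. {x \<in> X. \<alpha> s x \<in> N}) \<le> (\<Sum>s\<in>S. prob {x \<in> X. \<alpha> s x \<in> N})"
    using SN_sets S by (intro finite_measure_subadditive_finite) auto
  also have "\<dots> = real (card S) * prob N"
    using S N_sets by (simp add: prob_act subset_iff)
  also have "prob N + \<dots> = (1 + real (card S)) * prob N"
    by (simp add: algebra_simps)
  also have "\<dots> \<le> (1 + real (card S)) * \<epsilon>"
    using N_bound by (intro mult_left_mono) auto
  also have "\<dots> = \<delta>"
    by (simp add: \<epsilon>_def add.commute)
  finally have B_bound: "prob B \<le> \<delta>" by simp

  show thesis
  proof (rule that)
    show "t x \<in> carrier G" for x using t_F FG by blast
    show "finite (t ` X)" using t_F F(1) by (auto intro: finite_subset)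
    show "{x \<in> X. t x = f} \<in> sets M" for f
    proof -
      have "{x \<in> X. t x = f} = (\<Union>n. {x \<in> X. tower x f n}) \<union>
          (if f = f0 then X - (\<Union>n. \<Union>f\<in>F. {x \<in> X. tower x f n}) else {})"
        (is "_ = ?T")
      proof (rule Set.set_eqI)
        fix x
        show "x \<in> {x \<in> X. t x = f} \<longleftrightarrow> x \<in> ?T"
        proof (cases "\<exists>f n. tower x f n")
          case True
          then obtain f' n where f': "tower x f' n" by blast
          have "(\<exists>n. tower x f n) \<longleftrightarrow> t x = f"
            using t_eq[OF f'] f' tower_unique by blast
          moreover have "\<exists>n. \<exists>f\<in>F. tower x f n"
            using f' by (auto simp: tower_def)
          ultimately show ?thesis by auto
        next
          case False
          then show ?thesis by (auto simp: t_def)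
        qed
      qed
      moreover have "?T \<in> sets M"
        using X_sets tower_sets F(1) by (intro sets.Un) (auto intro!: sets.Diff sets.countable_UN sets.finite_UN)
      ultimately show ?thesis by simp
    qed
    show "B \<in> sets M" "prob B \<le> \<delta>" by fact+
    show "t (\<alpha> s x) = s \<otimes> t x" if x: "x \<in> X" "x \<notin> B" and s: "s \<in> S" for x s
    proof -
      have sG: "s \<in> carrier G" using s S by blast
      have sS: "s \<in> S'" "inv s \<in> S'" using s by (auto simp: S'_def)
      have y: "\<alpha> s x \<in> X" using x sG act_X by blast
      have "x \<notin> N" "\<alpha> s x \<notin> N" using x s by (auto simp: B_def)
      have off_N: "\<exists>f n. tower z f n \<and> f \<notin> D" if z: "z \<in> X" "z \<notin> N" for z
      proof -
        obtain f n where "tower z f n" using tower_ex[of z] z by (auto simp: N_def)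
        then show ?thesis using z by (auto simp: N_def)
      qed
      obtain f n where f: "tower x f n" "f \<notin> D"
        using off_N[OF x(1) \<open>x \<notin> N\<close>] by blast
      obtain f' m where f': "tower (\<alpha> s x) f' m" "f' \<notin> D"
        using off_N[OF y \<open>\<alpha> s x \<notin> N\<close>] by blast
      have "f' = s \<otimes> f"
      \<comment> \<open>The point removed later is still present when the other one is removed, so
        \<open>transport\<close> applies, with \<open>s\<close> or with
        \<open>inv s\<close>.\<close>
      proof (cases "n \<le> m")
        case True
        then have "\<alpha> s x \<in> Y n" using f' decY by (auto simp: tower_def)
        from transport[OF f sS(1) this] show ?thesis using f' tower_unique by blast
      next
        case False
        then have "\<alpha> (inv s) (\<alpha> s x) \<in> Y m"
          using f decY[of m n] x sG by (auto simp: tower_def act_inv)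
        from transport[OF f' sS(2) this] have "tower x (inv s \<otimes> f') m"
          using x sG by (simp add: act_inv)
        then have "f = inv s \<otimes> f'" using f tower_unique by blast
        then show ?thesis using f' sG FG by (simp add: tower_def flip: m_assoc)
      qed
      then show ?thesis using t_eq f f' by blast
    qed
  qed
qed

text \<open>The errors \<open>(1/2)^k\<close> are summable, so by Borel-Cantelli almost every
  \<open>x\<close> is eventually outside \<open>B k\<close>; and every \<open>g\<close> is
  eventually in \<open>S k\<close>.\<close>

lemma equivariant_sequence:
  assumes folner: "folner_sequence G Fn"
  obtains t :: "nat \<Rightarrow> 'x \<Rightarrow> 'g" where
    "\<And>k x. x \<in> X \<Longrightarrow> t k x \<in> carrier G" "\<And>k. finite (t k ` X)" "\<And>k f. {x \<in> X. t k x = f} \<in> sets M"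
    "AE x in M. x \<in> X \<longrightarrow> (\<forall>g\<in>carrier G. eventually (\<lambda>k. t k (\<alpha> g x) = g \<otimes> t k x) sequentially)"
proof -
  define S where "S k = from_nat_into (carrier G) ` {..<k}" for k :: nat
  have S: "finite (S k)" "S k \<subseteq> carrier G" for k
    using from_nat_into[of "carrier G"] by (auto simp: S_def)
  have S_ev: "eventually (\<lambda>k. g \<in> S k) sequentially" if g: "g \<in> carrier G" for g
  proof -
    obtain i where "from_nat_into (carrier G) i = g"
      using from_nat_into_to_nat_on[OF countable_carrier g] by blast
    then have "g \<in> S k" if "k \<ge> Suc i" for k
      using that by (auto simp: S_def)
    then show ?thesis by (auto simp: eventually_sequentially)
  qed
  define P where "P k t B \<longleftrightarrow> (\<forall>x\<in>X. t x \<in> carrier G) \<and> finite (t ` X) \<and>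
      (\<forall>f. {x \<in> X. t x = f} \<in> sets M) \<and> B \<in> sets M \<and> prob B \<le> (1/2)^k \<and>
      (\<forall>x\<in>X. x \<notin> B \<longrightarrow> (\<forall>s\<in>S k. t (\<alpha> s x) = s \<otimes> t x))" for k t B
  have "\<exists>t B. P k t B" for k
    unfolding P_def
    by (rule equivariant_approximation[OF folner S(1)[of k] S(2)[of k], of "(1/2)^k"]) (simp, blast)
  then obtain t B where P: "\<And>k. P k (t k) (B k)" by metis
  have tB: "\<And>k x. x \<in> X \<Longrightarrow> t k x \<in> carrier G" "\<And>k. finite (t k ` X)"
    "\<And>k f. {x \<in> X. t k x = f} \<in> sets M" "\<And>k. B k \<in> sets M" "\<And>k. prob (B k) \<le> (1/2)^k"
    "\<And>k x s. x \<in> X \<Longrightarrow> x \<notin> B k \<Longrightarrow> s \<in> S k \<Longrightarrow> t k (\<alpha> s x) = s \<otimes> t k x"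
    using P unfolding P_def by simp_all
  have "summable (\<lambda>k. prob (B k))"
    by (rule summable_comparison_test'[OF summable_geometric[of "1/2::real"], of 0]) (use tB(5) in auto)
  then have "AE x in M. eventually (\<lambda>k. x \<in> space M - B k) sequentially"
    using tB(4) by (intro borel_cantelli_AE1) (auto simp: emeasure_eq_measure)
  then have "AE x in M. x \<in> X \<longrightarrow> (\<forall>g\<in>carrier G. eventually (\<lambda>k. t k (\<alpha> g x) = g \<otimes> t k x) sequentially)"
  proof eventually_elim
    case (elim x)
    show ?case
    proof (intro impI ballI)
      fix g assume "x \<in> X" "g \<in> carrier G"
      show "eventually (\<lambda>k. t k (\<alpha> g x) = g \<otimes> t k x) sequentially"
        using elim S_ev[OF \<open>g \<in> carrier G\<close>] by eventually_elim (use tB(6) \<open>x \<in> X\<close> in auto)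
    qed
  qed
  then show thesis
    using that[of t] tB(1-3) by blast
qed

end

section \<open>Orders of type Z from coarsening keys\<close>

text \<open>For coarsening keys, agreement at level \<open>Suc n\<close> persists at all higher
  levels, so \<open>n\<close> is the last level at which the keys differ.\<close>

definition key_order :: "'a set \<Rightarrow> (nat \<Rightarrow> 'a \<Rightarrow> real) \<Rightarrow> 'a rel" where
  "key_order I m = {(a, b) \<in> I \<times> I. \<exists>n. m (Suc n) a = m (Suc n) b \<and> m n a < m n b}"

text \<open>The keys at level \<open>n\<close> name the classes of an equivalence relation on
  \<open>I\<close>. These relations have finite classes and increase from equality to the full
  relation.\<close>

locale coarsening_keys =
  fixes I :: "'a set" and m :: "nat \<Rightarrow> 'a \<Rightarrow> real"
  assumes coarsen: "a \<in> I \<Longrightarrow> b \<in> I \<Longrightarrow> m n a = m n b \<Longrightarrow> m (Suc n) a = m (Suc n) b"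
    and inj_0: "inj_on (m 0) I"
    and merge: "a \<in> I \<Longrightarrow> b \<in> I \<Longrightarrow> \<exists>n. m n a = m n b"
    and finite_class: "a \<in> I \<Longrightarrow> finite {b \<in> I. m n b = m n a}"
begin

lemma coarsen_le:
  assumes "a \<in> I" "b \<in> I" "m n a = m n b" "n \<le> k"
  shows "m k a = m k b"
  using assms(4) by (induction rule: dec_induct) (blast intro: assms(1-3) coarsen)+

lemma key_orderE:
  assumes "(a, b) \<in> key_order I m"
  obtains n where "a \<in> I" "b \<in> I" "m n a < m n b" "\<forall>k>n. m k a = m k b"
proof -
  obtain n where n: "a \<in> I" "b \<in> I" "m n a < m n b" "m (Suc n) a = m (Suc n) b"
    using assms by (auto simp: key_order_def)
  then have "\<forall>k>n. m k a = m k b"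
    using coarsen_le[OF n(1,2,4)] by simp
  with n show thesis by (intro that)
qed

lemma key_orderI:
  "a \<in> I \<Longrightarrow> b \<in> I \<Longrightarrow> m n a < m n b \<Longrightarrow> m (Suc n) a = m (Suc n) b \<Longrightarrow> (a, b) \<in> key_order I m"
  by (auto simp: key_order_def)

text \<open>For transitivity the deciding level is the larger of the two given ones. For totality it
  is the predecessor of the first level of agreement, which is positive because \<open>m 0\<close>
  is injective.\<close>

lemma strict_linear_order_key_order: "strict_linear_order_on I (key_order I m)"
proof -
  have "trans (key_order I m)"
  proof (rule transI)
    fix a b c
    assume ab: "(a, b) \<in> key_order I m" and bc: "(b, c) \<in> key_order I m"
    obtain n where n: "a \<in> I" "b \<in> I" "m n a < m n b" "\<forall>k>n. m k a = m k b"
      by (rule key_orderE[OF ab])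
    obtain k where k: "c \<in> I" "m k b < m k c" "\<forall>j>k. m j b = m j c"
      by (rule key_orderE[OF bc])
    show "(a, c) \<in> key_order I m"
    proof (rule key_orderI[OF n(1) k(1), of "max n k"])
      show "m (max n k) a < m (max n k) c"
        using n(3,4) k(2,3) by (cases n k rule: linorder_cases) (auto simp: max_def intro: less_trans)
      show "m (Suc (max n k)) a = m (Suc (max n k)) c"
        using n(4) k(3) by simp
    qed
  qed
  moreover have "irrefl (key_order I m)"
    by (auto simp: irrefl_def key_order_def)
  moreover have "total_on I (key_order I m)"
  proof (rule total_onI)
    fix a b assume ab: "a \<in> I" "b \<in> I" "a \<noteq> b"
    define n where "n = (LEAST n. m n a = m n b)"
    have n: "m n a = m n b"
      unfolding n_def using merge[OF ab(1,2)] by (rule LeastI_ex)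
    have "n \<noteq> 0" using n inj_on_contraD[OF inj_0 ab(3,1,2)] by (cases n) auto
    then obtain k where k: "n = Suc k" by (cases n) auto
    then have "m k a \<noteq> m k b"
      using not_less_Least[of k "\<lambda>n. m n a = m n b"] by (simp add: n_def)
    then show "(a, b) \<in> key_order I m \<or> (b, a) \<in> key_order I m"
      using key_orderI[OF ab(1,2), of k] key_orderI[OF ab(2,1), of k] n k by (auto simp: neq_iff)
  qed
  ultimately show ?thesis
    by (simp add: strict_linear_order_on_def)
qed

text \<open>If \<open>g\<close> were outside the class, both comparisons would be decided at levels
  \<open>\<ge> N\<close>, where \<open>a\<close> and \<open>b\<close> agree. Then \<open>g\<close>
  would lie on the same side of both.\<close>

lemma key_order_interval_class:
  assumes ag: "(a, g) \<in> key_order I m" and gb: "(g, b) \<in> key_order I m" and eq: "m N a = m N b"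
  shows "m N g = m N a"
proof (rule ccontr)
  assume neq: "m N g \<noteq> m N a"
  obtain n where n: "a \<in> I" "g \<in> I" "m n a < m n g" "\<forall>k>n. m k a = m k g"
    by (rule key_orderE[OF ag])
  obtain k where k: "b \<in> I" "m k g < m k b" "\<forall>j>k. m j g = m j b"
    by (rule key_orderE[OF gb])
  have "N \<le> n" using n(4) neq not_le_imp_less by metis
  moreover have "N \<le> k" using k(3) neq eq not_le_imp_less by metis
  ultimately have "m n a = m n b" "m k a = m k b"
    using coarsen_le[OF n(1) k(1) eq] by auto
  then show False
    using n(3,4) k(2,3) by (cases n k rule: linorder_cases) auto
qed

lemma finite_key_order_interval:
  assumes "(a, b) \<in> key_order I m"
  shows "finite {g. (a, g) \<in> key_order I m \<and> (g, b) \<in> key_order I m}"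
proof -
  have ab: "a \<in> I" "b \<in> I" using assms by (auto simp: key_order_def)
  then obtain N where N: "m N a = m N b" using merge by blast
  have "{g. (a, g) \<in> key_order I m \<and> (g, b) \<in> key_order I m} \<subseteq> {g \<in> I. m N g = m N a}"
    using key_order_interval_class[OF _ _ N] by (auto simp: key_order_def)
  then show ?thesis
    using finite_class[OF ab(1)] by (rule finite_subset)
qed

end

section \<open>Keys along the orbits of the action\<close>

context free_pmp_action
begin

text \<open>Such a set meets every orbit at most once, so more than \<open>1 / prob B\<close> of its
  translates would be disjoint and overfill the space.\<close>

lemma null_if_disjoint_translates:
  assumes inf: "infinite (carrier G)" and B: "B \<in> sets M" "B \<subseteq> X"
    and disj: "\<And>x g. x \<in> B \<Longrightarrow> g \<in> carrier G \<Longrightarrow> \<alpha> g x \<in> B \<Longrightarrow> g = \<one>"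
  shows "prob B = 0"
proof (rule ccontr)
  assume "prob B \<noteq> 0"
  then have pos: "0 < prob B" by (simp add: less_le)
  obtain n :: nat where n: "1 < real n * prob B"
    using reals_Archimedean3[OF pos] by blast
  obtain K where K: "finite K" "card K = n" "K \<subseteq> carrier G"
    using infinite_arbitrarily_large[OF inf] by blast
  have sets: "{x \<in> X. \<alpha> g x \<in> B} \<in> sets M" if "g \<in> K" for g
    using that K B by (auto intro!: sets_act)
  have "disjoint_family_on (\<lambda>g. {x \<in> X. \<alpha> g x \<in> B}) K"
  proof -
    have "g = g'" if "g \<in> K" "g' \<in> K" "x \<in> X" "\<alpha> g x \<in> B" "\<alpha> g' x \<in> B" for g g' x
    proof -
      have gG: "g \<in> carrier G" "g' \<in> carrier G" using that K by auto
      have "\<alpha> (g' \<otimes> inv g) (\<alpha> g x) = \<alpha> g' x"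
        using that gG by (simp add: act_mult act_X m_assoc)
      then have "g' \<otimes> inv g = \<one>"
        using disj[OF that(4), of "g' \<otimes> inv g"] that gG by simp
      then show ?thesis using gG by (metis inv_equality inv_inv inv_closed)
    qed
    then show ?thesis by (auto simp: disjoint_family_on_def)
  qed
  then have "prob (\<Union>g\<in>K. {x \<in> X. \<alpha> g x \<in> B}) = (\<Sum>g\<in>K. prob {x \<in> X. \<alpha> g x \<in> B})"
    using sets K by (intro finite_measure_finite_Union) auto
  also have "\<dots> = real n * prob B"
    using K B by (simp add: prob_act subset_iff)
  finally show False using n prob_le_1[of "\<Union>g\<in>K. {x \<in> X. \<alpha> g x \<in> B}"] by simp
qed

text \<open>The keys depend on the point of the orbit only, so viewing the orbit from another base
  point merely shifts the argument. This later makes the order equivariant.\<close>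

lemma invariant_keys:
  assumes folner: "folner_sequence G Fn"
  obtains m :: "nat \<Rightarrow> 'x \<Rightarrow> real" where "\<And>n. m n \<in> borel_measurable M"
    "AE x in M. x \<in> X \<longrightarrow> coarsening_keys (carrier G) (\<lambda>n g. m n (\<alpha> g x))"
proof -
  obtain t where t_G: "\<And>k x. x \<in> X \<Longrightarrow> t k x \<in> carrier G" and t_fin: "\<And>k. finite (t k ` X)"
    and t_sets: "\<And>k f. {x \<in> X. t k x = f} \<in> sets M"
    and t_ev: "AE x in M. x \<in> X \<longrightarrow> (\<forall>g\<in>carrier G. eventually (\<lambda>k. t k (\<alpha> g x) = g \<otimes> t k x) sequentially)"
    by (rule equivariant_sequence[OF folner]) blast
  \<comment> \<open>\<open>C n x\<close> is the class of \<open>x\<close> under the intersection of the relations given by all \<open>t k\<close> with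
    \<open>k \<ge> n\<close>. These relations increase with \<open>n\<close>, and \<open>m (Suc n)\<close> labels their classes.\<close>
  define C where "C n x = {b \<in> carrier G. \<forall>k\<ge>n. t k (\<alpha> b x) = b \<otimes> t k x}" for n x
  \<comment> \<open>Level 0 is \<open>h\<close> itself, so that the classes start as singletons;
    this causes the index shift. At later levels the value 0 off \<open>X\<close> keeps the key
    measurable.\<close>
  define m where "m n x = (case n of 0 \<Rightarrow> h x | Suc n \<Rightarrow>
      if x \<in> X then Min ((\<lambda>b. h (\<alpha> b x)) ` C n x) else 0)" for n x
  have m_0: "m 0 x = h x" and m_Suc: "x \<in> X \<Longrightarrow> m (Suc n) x = Min ((\<lambda>b. h (\<alpha> b x)) ` C n x)" for n x
    by (auto simp: m_def)
  have C_G: "C n x \<subseteq> carrier G" for n x by (auto simp: C_def)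
  have C_one: "\<one> \<in> C n x" if "x \<in> X" for n x
    using that by (auto simp: C_def act_one t_G)
  \<comment> \<open>An element \<open>b\<close> of the class is recovered from
    \<open>t n (\<alpha> b x)\<close>, which takes finitely many values.\<close>
  have C_fin: "finite (C n x)" if x: "x \<in> X" for n x
  proof (rule finite_subset)
    show "C n x \<subseteq> (\<lambda>f. f \<otimes> inv (t n x)) ` t n ` X"
    proof
      fix b assume b: "b \<in> C n x"
      then have bG: "b \<in> carrier G" and "t n (\<alpha> b x) = b \<otimes> t n x" by (auto simp: C_def)
      then have "b = t n (\<alpha> b x) \<otimes> inv (t n x)"
        using x t_G[OF x] by (simp add: m_assoc)
      then show "b \<in> (\<lambda>f. f \<otimes> inv (t n x)) ` t n ` X"
        using act_X[OF x bG] by blast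
    qed
    show "finite ((\<lambda>f. f \<otimes> inv (t n x)) ` t n ` X)"
      using t_fin by simp
  qed
  have C_shift: "b \<in> C n (\<alpha> a x) \<longleftrightarrow> b \<otimes> a \<in> C n x"
    if x: "x \<in> X" and a: "a \<in> C n x" and b: "b \<in> carrier G" for a b n x
    using x a b t_G[OF x] by (auto simp: C_def act_mult m_assoc)
  have m_attained: "\<exists>b\<in>C n x. m (Suc n) x = h (\<alpha> b x)" if x: "x \<in> X" for n x
  proof -
    have "Min ((\<lambda>b. h (\<alpha> b x)) ` C n x) \<in> (\<lambda>b. h (\<alpha> b x)) ` C n x"
      using C_fin[OF x] C_one[OF x] by (intro Min_in) blast+
    then show ?thesis unfolding m_Suc[OF x] by blast
  qed
  \<comment> \<open>Equal minima of the injective \<open>h\<close> are attained at one common point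
    \<open>\<alpha> b x = \<alpha> c (\<alpha> a x)\<close>. Freeness gives
    \<open>b = c \<otimes> a\<close>, and cancelling \<open>c\<close> puts \<open>a\<close> into the
    class.\<close>
  have m_class: "m (Suc n) (\<alpha> a x) = m (Suc n) x \<longleftrightarrow> a \<in> C n x"
    if x: "x \<in> X" and a: "a \<in> carrier G" for a n x
  proof
    assume a_C: "a \<in> C n x"
    have "(\<lambda>b. h (\<alpha> b (\<alpha> a x))) ` C n (\<alpha> a x) = (\<lambda>b. h (\<alpha> b x)) ` C n x"
    proof (intro equalityI subsetI; elim imageE)
      fix y b assume y: "y = h (\<alpha> b (\<alpha> a x))" "b \<in> C n (\<alpha> a x)"
      then have "b \<otimes> a \<in> C n x" using C_shift[OF x a_C] C_G by blast
      moreover have "y = h (\<alpha> (b \<otimes> a) x)" using y x a C_G by (simp add: act_mult subset_iff)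
      ultimately show "y \<in> (\<lambda>b. h (\<alpha> b x)) ` C n x" by blast
    next
      fix y b assume y: "y = h (\<alpha> b x)" "b \<in> C n x"
      then have b: "b \<in> carrier G" using C_G by blast
      then have "b \<otimes> inv a \<in> C n (\<alpha> a x)"
        using C_shift[OF x a_C, of "b \<otimes> inv a"] a y by (simp add: m_assoc)
      moreover have "y = h (\<alpha> (b \<otimes> inv a) (\<alpha> a x))"
        using y x a b by (simp add: act_mult m_assoc)
      ultimately show "y \<in> (\<lambda>b. h (\<alpha> b (\<alpha> a x))) ` C n (\<alpha> a x)" by blast
    qed
    then show "m (Suc n) (\<alpha> a x) = m (Suc n) x"
      using x a act_X by (simp add: m_Suc)
  next
    assume eq: "m (Suc n) (\<alpha> a x) = m (Suc n) x"
    obtain b where b: "b \<in> C n x" "m (Suc n) x = h (\<alpha> b x)"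
      using m_attained[OF x] by blast
    obtain c where c: "c \<in> C n (\<alpha> a x)" "m (Suc n) (\<alpha> a x) = h (\<alpha> c (\<alpha> a x))"
      using m_attained[OF act_X[OF x a]] by blast
    have bc: "b \<in> carrier G" "c \<in> carrier G" using b c C_G by blast+
    have "\<alpha> b x = \<alpha> c (\<alpha> a x)"
      using eq b c bc x a act_X by (intro inj_onD[OF inj_h]) auto
    also have "\<dots> = \<alpha> (c \<otimes> a) x"
      using bc x a by (simp add: act_mult)
    finally have b_eq: "b = c \<otimes> a"
      using bc x a by (intro act_inj) auto
    show "a \<in> C n x"
      unfolding C_def
    proof (intro CollectI conjI allI impI a)
      fix k assume "n \<le> k"
      then have "t k (\<alpha> b x) = b \<otimes> t k x" "t k (\<alpha> c (\<alpha> a x)) = c \<otimes> t k (\<alpha> a x)"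
        using b c by (auto simp: C_def)
      then have "c \<otimes> t k (\<alpha> a x) = c \<otimes> (a \<otimes> t k x)"
        using \<open>\<alpha> b x = \<alpha> c (\<alpha> a x)\<close> b_eq bc a t_G[OF x] by (simp add: m_assoc)
      then show "t k (\<alpha> a x) = a \<otimes> t k x"
        using bc a t_G x act_X[OF x a] by simp
    qed
  qed

  have keys: "coarsening_keys (carrier G) (\<lambda>n g. m n (\<alpha> g x))"
    if x: "x \<in> X" and ev: "\<And>g. g \<in> carrier G \<Longrightarrow> eventually (\<lambda>k. t k (\<alpha> g x) = g \<otimes> t k x) sequentially" for x
  proof
    have C_mono: "C n y \<subseteq> C (Suc n) y" for n y by (auto simp: C_def)
    have shift: "\<alpha> b x = \<alpha> (b \<otimes> inv a) (\<alpha> a x)" if "a \<in> carrier G" "b \<in> carrier G" for a b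
      using that x by (simp add: act_mult m_assoc)
    have cls: "m (Suc n) (\<alpha> b x) = m (Suc n) (\<alpha> a x) \<longleftrightarrow> b \<otimes> inv a \<in> C n (\<alpha> a x)"
      if "a \<in> carrier G" "b \<in> carrier G" for a b n
      using m_class[OF act_X[OF x that(1)], of "b \<otimes> inv a" n] that by (simp flip: shift)
    show inj: "inj_on (\<lambda>g. m 0 (\<alpha> g x)) (carrier G)"
    proof (rule inj_onI)
      fix a b assume "a \<in> carrier G" "b \<in> carrier G" "m 0 (\<alpha> a x) = m 0 (\<alpha> b x)"
      then show "a = b"
        using act_inj[OF x] inj_onD[OF inj_h] act_X[OF x] by (simp add: m_0)
    qed
    show "m (Suc n) (\<alpha> a x) = m (Suc n) (\<alpha> b x)"
      if "a \<in> carrier G" "b \<in> carrier G" "m n (\<alpha> a x) = m n (\<alpha> b x)" for a b n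
    proof (cases n)
      case 0
      then have "a = b" using inj_onD[OF inj] that by simp
      then show ?thesis by simp
    next
      case (Suc k)
      then show ?thesis
        using cls[OF that(2,1), of k] cls[OF that(2,1), of "Suc k"] that(3) C_mono by auto
    qed
    show "finite {b \<in> carrier G. m n (\<alpha> b x) = m n (\<alpha> a x)}" if a: "a \<in> carrier G" for n a
    proof (cases n)
      case 0
      then have "{b \<in> carrier G. m n (\<alpha> b x) = m n (\<alpha> a x)} \<subseteq> {a}"
        using inj_onD[OF inj _ _ a] by auto
      then show ?thesis by (rule finite_subset) simp
    next
      case (Suc k)
      have "{b \<in> carrier G. m n (\<alpha> b x) = m n (\<alpha> a x)} \<subseteq> (\<lambda>c. c \<otimes> a) ` C k (\<alpha> a x)"
      proof
        fix b assume "b \<in> {b \<in> carrier G. m n (\<alpha> b x) = m n (\<alpha> a x)}"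
        then have b: "b \<in> carrier G" "b \<otimes> inv a \<in> C k (\<alpha> a x)"
          using cls[OF a] Suc by auto
        then have "b = (b \<otimes> inv a) \<otimes> a" using a by (simp add: m_assoc)
        then show "b \<in> (\<lambda>c. c \<otimes> a) ` C k (\<alpha> a x)" using b(2) by (rule image_eqI)
      qed
      then show ?thesis
        using C_fin[OF act_X[OF x a]] by (rule finite_subset[OF _ finite_imageI])
    qed
    show "\<exists>n. m n (\<alpha> a x) = m n (\<alpha> b x)" if ab: "a \<in> carrier G" "b \<in> carrier G" for a b
    proof -
      obtain n where n: "\<And>k. k \<ge> n \<Longrightarrow> t k (\<alpha> a x) = a \<otimes> t k x \<and> t k (\<alpha> b x) = b \<otimes> t k x"
        using eventually_conj[OF ev[OF ab(1)] ev[OF ab(2)]] by (auto simp: eventually_sequentially)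
      then have "a \<in> C n x" "b \<in> C n x" using ab by (auto simp: C_def)
      then show ?thesis using m_class[OF x] ab by metis
    qed
  qed

  have C_sets: "{x \<in> X. b \<in> C n x} \<in> sets M" if b: "b \<in> carrier G" for b n
  proof -
    \<comment> \<open>Splitting by the value \<open>f\<close> of \<open>t k x\<close> gives a
      countable union of sets built from level sets of \<open>t k\<close>.\<close>
    have "{x \<in> X. t k (\<alpha> b x) = b \<otimes> t k x} \<in> sets M" for k
    proof -
      have "{x \<in> X. t k (\<alpha> b x) = b \<otimes> t k x} =
          (\<Union>f\<in>carrier G. {x \<in> X. t k x = f} \<inter> {x \<in> X. \<alpha> b x \<in> {y \<in> X. t k y = b \<otimes> f}})"
        using t_G act_X b by auto
      also have "\<dots> \<in> sets M"
        by (intro sets.countable_UN' image_subsetI sets.Int t_sets sets_act b countable_carrier)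
      finally show ?thesis .
    qed
    moreover have "{x \<in> X. b \<in> C n x} = X \<inter> (\<Inter>k\<in>{n..}. {x \<in> X. t k (\<alpha> b x) = b \<otimes> t k x})"
      using b by (auto simp: C_def)
    ultimately show ?thesis
      using X_sets by (auto intro!: sets.Int sets.countable_INT')
  qed
  have m_meas: "m n \<in> borel_measurable M" for n
  proof (cases n)
    case 0
    have "m 0 = h" by (simp add: fun_eq_iff m_0)
    then show ?thesis using 0 h_measurable by simp
  next
    case (Suc k)
    show ?thesis
      unfolding borel_measurable_iff_less
    proof
      fix c
      \<comment> \<open>A finite minimum is below \<open>c\<close> iff some entry is, which yields a
        countable union over the group; the last set accounts for the value 0 off
        \<open>X\<close>.\<close>
      have "{w \<in> space M. m n w < c} =
          (\<Union>b\<in>carrier G. {x \<in> X. b \<in> C k x} \<inter> {x \<in> X. \<alpha> b x \<in> {y \<in> space M. h y < c}}) \<union>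
          (if 0 < c then space M - X else {})"
      proof -
        have "m n w < c \<longleftrightarrow> (\<exists>b\<in>carrier G. b \<in> C k w \<and> h (\<alpha> b w) < c)" if "w \<in> X" for w
        proof -
          have "m n w < c \<longleftrightarrow> (\<exists>b\<in>C k w. h (\<alpha> b w) < c)"
            unfolding Suc m_Suc[OF that] using C_fin[OF that, of k] C_one[OF that, of k]
            by (subst Min_less_iff) blast+
          then show ?thesis using C_G by blast
        qed
        moreover have "m n w = 0" if "w \<notin> X" for w
          using that by (simp add: Suc m_def)
        ultimately have "w \<in> {w \<in> space M. m n w < c} \<longleftrightarrow> w \<in>
            (\<Union>b\<in>carrier G. {x \<in> X. b \<in> C k x} \<inter> {x \<in> X. \<alpha> b x \<in> {y \<in> space M. h y < c}}) \<union>
            (if 0 < c then space M - X else {})" for w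
          using X_space act_X by (cases "w \<in> X") auto
        then show ?thesis by (rule Set.set_eqI)
      qed
      also have "\<dots> \<in> sets M"
      proof -
        have "{y \<in> space M. h y < c} \<in> sets M"
          using h_measurable by (simp add: borel_measurable_iff_less)
        then have "(\<Union>b\<in>carrier G. {x \<in> X. b \<in> C k x} \<inter> {x \<in> X. \<alpha> b x \<in> {y \<in> space M. h y < c}}) \<in> sets M"
          by (intro sets.countable_UN' image_subsetI sets.Int C_sets sets_act countable_carrier)
        then show ?thesis
          using X_sets by (intro sets.Un) auto
      qed
      finally show "{w \<in> space M. m n w < c} \<in> sets M" .
    qed
  qed
  show thesis
  proof (rule that[of m])
    show "m n \<in> borel_measurable M" for n by (rule m_meas)
    show "AE x in M. x \<in> X \<longrightarrow> coarsening_keys (carrier G) (\<lambda>n g. m n (\<alpha> g x))"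
      using t_ev by eventually_elim (use keys in blast)
  qed
qed

end

section \<open>The space of orders of type Z\<close>

text \<open>With countably many coordinates there are only countably many cylinders, so every open
  set is a countable union of them, and preimages of cylinders are finite intersections of
  coordinate conditions.\<close>

lemma measurable_cantor:
  fixes f :: "'x \<Rightarrow> 'i \<Rightarrow> bool"
  assumes I: "countable I" and ext: "\<And>x. x \<in> space N \<Longrightarrow> f x \<in> extensional I"
    and meas: "\<And>i. i \<in> I \<Longrightarrow> {x \<in> space N. f x i} \<in> sets N"
  shows "f \<in> measurable N (borel_of (product_topology (\<lambda>_. discrete_topology UNIV) I))"
  unfolding borel_of_def
proof (rule measurable_measure_of)
  let ?T = "product_topology (\<lambda>_. discrete_topology (UNIV :: bool set)) I"
  show "{U. openin ?T U} \<subseteq> Pow (topspace ?T)" using openin_subset[of ?T] by blast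
  show "f \<in> space N \<rightarrow> topspace ?T" using ext by (auto simp: PiE_def)
  fix U assume "U \<in> {U. openin ?T U}"
  then have U: "openin ?T U" by simp
  \<comment> \<open>\<open>W (J, K)\<close> is a cylinder: \<open>J\<close> lists the constrained
    coordinates, and \<open>K\<close> tells which of them are true.\<close>
  define W :: "'i set \<times> 'i set \<Rightarrow> ('i \<Rightarrow> bool) set"
    where "W = (\<lambda>(J, K). {u \<in> extensional I. \<forall>i\<in>J. u i = (i \<in> K)})"
  define S where "S = {JK \<in> {J. finite J \<and> J \<subseteq> I} \<times> {K. finite K \<and> K \<subseteq> I}. W JK \<subseteq> U}"
  have "countable ({J. finite J \<and> J \<subseteq> I} \<times> {K. finite K \<and> K \<subseteq> I})"
    using I by (intro countable_SIGMA countable_Collect_finite_subset)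
  then have S_count: "countable S"
    by (rule countable_subset[rotated]) (auto simp: S_def)
  have cyl: "\<exists>JK\<in>S. u \<in> W JK" if u: "u \<in> U" for u
  proof -
    obtain V where V: "finite {i \<in> I. V i \<noteq> UNIV}" "u \<in> Pi\<^sub>E I V" "Pi\<^sub>E I V \<subseteq> U"
      using U u unfolding openin_product_topology_alt by (auto dest!: bspec[of U _ u])
    define J where "J = {i \<in> I. V i \<noteq> UNIV}"
    define K where "K = {i \<in> J. u i}"
    have "W (J, K) \<subseteq> Pi\<^sub>E I V"
    proof
      fix w assume w: "w \<in> W (J, K)"
      have "w i \<in> V i" if "i \<in> I" for i
      proof (cases "i \<in> J")
        case True
        then have "w i = u i" using w by (auto simp: W_def K_def)
        then show ?thesis using V(2) that by auto
      next
        case False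
        then show ?thesis using that by (auto simp: J_def)
      qed
      then show "w \<in> Pi\<^sub>E I V" using w by (auto simp: W_def PiE_def)
    qed
    moreover have "u \<in> W (J, K)" using V(2) by (auto simp: W_def K_def PiE_def)
    moreover have "finite J" "J \<subseteq> I" using V(1) by (auto simp: J_def)
    moreover from this have "finite K" "K \<subseteq> I" by (auto simp: K_def)
    ultimately have "u \<in> W (J, K)" "(J, K) \<in> S"
      using V(3) unfolding S_def by simp_all
    then show ?thesis by blast
  qed
  have "f -` U \<inter> space N = (\<Union>JK\<in>S. {x \<in> space N. f x \<in> W JK})"
    using cyl by (auto simp: S_def)
  also have "\<dots> \<in> sets N"
  proof (intro sets.countable_UN' S_count image_subsetI)
    fix JK assume "JK \<in> S"
    then obtain J K where JK: "JK = (J, K)" "finite J" "J \<subseteq> I"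
      by (auto simp: S_def)
    have "{x \<in> space N. f x i = (i \<in> K)} \<in> sets N" if "i \<in> J" for i
    proof -
      have i: "{x \<in> space N. f x i} \<in> sets N" using that JK meas by blast
      have "{x \<in> space N. f x i = (i \<in> K)} =
          (if i \<in> K then {x \<in> space N. f x i} else space N - {x \<in> space N. f x i})"
        by auto
      then show ?thesis using i by auto
    qed
    then have "{x \<in> space N. \<forall>i\<in>J. f x i = (i \<in> K)} \<in> sets N"
      using JK(2) by (intro sets.sets_Collect_finite_All) auto
    moreover have "{x \<in> space N. f x \<in> W JK} = {x \<in> space N. \<forall>i\<in>J. f x i = (i \<in> K)}"
      using ext by (auto simp: W_def JK)
    ultimately show "{x \<in> space N. f x \<in> W JK} \<in> sets N" by simp
  qed
  finally show "f -` U \<inter> space N \<in> sets N" .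
qed

lemma space_Z_orders_algebra: "space (Z_orders_algebra G) = Z_orders G"
  by (simp add: Z_orders_algebra_def)

lemma measurable_Z_orders:
  assumes "countable (carrier G)" and r: "\<And>x. x \<in> space N \<Longrightarrow> r x \<in> Z_orders G"
    and meas: "\<And>a b. a \<in> carrier G \<Longrightarrow> b \<in> carrier G \<Longrightarrow> {x \<in> space N. (a, b) \<in> r x} \<in> sets N"
  shows "r \<in> measurable N (Z_orders_algebra G)"
  unfolding Z_orders_algebra_def
proof (rule measurable_vimage_algebra2)
  show "r \<in> space N \<rightarrow> Z_orders G" using r by blast
  show "(\<lambda>x. \<lambda>p\<in>carrier G \<times> carrier G. p \<in> r x) \<in> measurable N (borel_of (cantor_topology G))"
    unfolding cantor_topology_def
  proof (rule measurable_cantor)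
    show "countable (carrier G \<times> carrier G)" using assms(1) by simp
  qed (use meas in auto)
qed

lemma sets_Z_orders_coordinate:
  assumes ab: "a \<in> carrier G" "b \<in> carrier G"
  shows "{r \<in> Z_orders G. (a, b) \<in> r} \<in> sets (Z_orders_algebra G)"
proof -
  let ?e = "\<lambda>r. \<lambda>p\<in>carrier G \<times> carrier G. p \<in> r"
  let ?U = "{u \<in> topspace (cantor_topology G). u (a, b) \<in> {True}}"
  have "openin (cantor_topology G) ?U"
    unfolding cantor_topology_def
    by (rule openin_continuous_map_preimage[OF continuous_map_product_projection]) (use ab in auto)
  then have "?U \<in> sets (borel_of (cantor_topology G))"
    unfolding borel_of_def by (subst sets_measure_of) (auto dest: openin_subset)
  then have "?e -` ?U \<inter> Z_orders G \<in> sets (Z_orders_algebra G)"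
    unfolding Z_orders_algebra_def by (rule in_vimage_algebra)
  moreover have "?e -` ?U \<inter> Z_orders G = {r \<in> Z_orders G. (a, b) \<in> r}"
    using ab by (auto simp: cantor_topology_def)
  ultimately show ?thesis by simp
qed

section \<open>The action of the group on its orders of type Z\<close>

context group
begin

text \<open>Right multiplication by \<open>g\<close> is a bijection of the group that carries the
  new order to the old one, so all properties transfer.\<close>

lemma order_action_Z_orders:
  assumes g: "g \<in> carrier G" and r: "r \<in> Z_orders G"
  shows "order_action G g r \<in> Z_orders G"
proof -
  have r_sub: "r \<subseteq> carrier G \<times> carrier G" and r_trans: "trans r" and r_irr: "irrefl r"
    and r_tot: "total_on (carrier G) r"
    and r_fin: "\<And>a b. (a, b) \<in> r \<Longrightarrow> finite {c. (a, c) \<in> r \<and> (c, b) \<in> r}"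
    and r_min: "\<And>a. a \<in> carrier G \<Longrightarrow> \<exists>b\<in>carrier G. (b, a) \<in> r"
    and r_max: "\<And>a. a \<in> carrier G \<Longrightarrow> \<exists>b\<in>carrier G. (a, b) \<in> r"
    using r by (auto simp: Z_orders_def strict_linear_order_on_def)
  define s where "s = {(a, b) \<in> carrier G \<times> carrier G. (a \<otimes> g, b \<otimes> g) \<in> r}"
  have s_iff: "(a, b) \<in> s \<longleftrightarrow> a \<in> carrier G \<and> b \<in> carrier G \<and> (a \<otimes> g, b \<otimes> g) \<in> r" for a b
    by (auto simp: s_def)
  have "trans s"
    by (rule transI) (auto simp: s_iff intro: transD[OF r_trans])
  moreover have "irrefl s"
    using r_irr by (auto simp: irrefl_def s_iff)
  moreover have "total_on (carrier G) s"
    using r_tot g by (auto simp: total_on_def s_iff)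
  moreover have "finite {c. (a, c) \<in> s \<and> (c, b) \<in> s}" if "(a, b) \<in> s" for a b
  proof (rule inj_on_finite[of "\<lambda>c. c \<otimes> g"])
    show "inj_on (\<lambda>c. c \<otimes> g) {c. (a, c) \<in> s \<and> (c, b) \<in> s}"
      using g by (auto simp: inj_on_def s_iff)
    show "(\<lambda>c. c \<otimes> g) ` {c. (a, c) \<in> s \<and> (c, b) \<in> s} \<subseteq> {c. (a \<otimes> g, c) \<in> r \<and> (c, b \<otimes> g) \<in> r}"
      by (auto simp: s_iff)
    show "finite {c. (a \<otimes> g, c) \<in> r \<and> (c, b \<otimes> g) \<in> r}"
      using that r_fin by (simp add: s_iff)
  qed
  moreover have "\<exists>b\<in>carrier G. (b, a) \<in> s" if a: "a \<in> carrier G" for a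
  proof -
    obtain b where b: "b \<in> carrier G" "(b, a \<otimes> g) \<in> r" using r_min[of "a \<otimes> g"] a g by auto
    then have "(b \<otimes> inv g, a) \<in> s" using a g by (simp add: s_iff m_assoc)
    then show ?thesis using b g by blast
  qed
  moreover have "\<exists>b\<in>carrier G. (a, b) \<in> s" if a: "a \<in> carrier G" for a
  proof -
    obtain b where b: "b \<in> carrier G" "(a \<otimes> g, b) \<in> r" using r_max[of "a \<otimes> g"] a g by auto
    then have "(a, b \<otimes> inv g) \<in> s" using a g by (simp add: s_iff m_assoc)
    then show ?thesis using b g by blast
  qed
  ultimately have "s \<in> Z_orders G"
    by (auto simp: Z_orders_def strict_linear_order_on_def s_def)
  then show ?thesis using r by (simp add: order_action_def s_def)
qed

lemma order_action_mult:
  assumes "a \<in> carrier G" "b \<in> carrier G" "r \<in> Z_orders G"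
  shows "order_action G a (order_action G b r) = order_action G (a \<otimes> b) r"
proof -
  have "order_action G b r \<in> Z_orders G" using assms order_action_Z_orders by blast
  then show ?thesis using assms by (auto simp: order_action_def m_assoc)
qed

lemma order_action_one: "r \<in> Z_orders G \<Longrightarrow> order_action G \<one> r = r"
  by (auto simp: order_action_def Z_orders_def)

lemma group_action_order_action: "group_action G (Z_orders G) (order_action G)"
proof -
  have bij: "order_action G g \<in> Bij (Z_orders G)" if g: "g \<in> carrier G" for g
  proof -
    have "bij_betw (order_action G g) (Z_orders G) (Z_orders G)"
      by (rule bij_betw_byWitness[of _ "order_action G (inv g)"])
        (use g in \<open>auto simp: order_action_mult order_action_one order_action_Z_orders\<close>)
    moreover have "order_action G g \<in> extensional (Z_orders G)"
      by (simp add: order_action_def)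
    ultimately show ?thesis by (simp add: Bij_def)
  qed
  have "order_action G \<in> hom G (BijGroup (Z_orders G))"
  proof (rule homI)
    show "order_action G g \<in> carrier (BijGroup (Z_orders G))" if "g \<in> carrier G" for g
      using bij[OF that] by (simp add: BijGroup_def)
    show "order_action G (a \<otimes> b) =
        order_action G a \<otimes>\<^bsub>BijGroup (Z_orders G)\<^esub> order_action G b"
      if ab: "a \<in> carrier G" "b \<in> carrier G" for a b
    proof -
      have "order_action G (a \<otimes> b) = compose (Z_orders G) (order_action G a) (order_action G b)"
      proof (rule extensionalityI[of _ "Z_orders G"])
        show "order_action G (a \<otimes> b) \<in> extensional (Z_orders G)"
          by (simp add: order_action_def)
        show "compose (Z_orders G) (order_action G a) (order_action G b) \<in> extensional (Z_orders G)"
          by (rule compose_extensional)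
        show "order_action G (a \<otimes> b) r = compose (Z_orders G) (order_action G a) (order_action G b) r"
          if "r \<in> Z_orders G" for r
          using that ab by (simp add: compose_eq order_action_mult)
      qed
      then show ?thesis using bij ab by (simp add: BijGroup_def)
    qed
  qed
  then show ?thesis
    by (intro group_action.intro group_hom.intro group_axioms group_BijGroup group_hom_axioms.intro)
qed

lemma order_action_measurable:
  assumes "countable (carrier G)" and g: "g \<in> carrier G"
  shows "order_action G g \<in> measurable (Z_orders_algebra G) (Z_orders_algebra G)"
proof (rule measurable_Z_orders)
  show "countable (carrier G)" by fact
  show "order_action G g r \<in> Z_orders G" if "r \<in> space (Z_orders_algebra G)" for r
    using that order_action_Z_orders[OF g] by (simp add: space_Z_orders_algebra)
  show "{r \<in> space (Z_orders_algebra G). (a, b) \<in> order_action G g r} \<in> sets (Z_orders_algebra G)"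
    if ab: "a \<in> carrier G" "b \<in> carrier G" for a b
  proof -
    have "{r \<in> space (Z_orders_algebra G). (a, b) \<in> order_action G g r} =
        {r \<in> Z_orders G. (a \<otimes> g, b \<otimes> g) \<in> r}"
      using ab by (auto simp: space_Z_orders_algebra order_action_def)
    then show ?thesis using ab g by (simp add: sets_Z_orders_coordinate)
  qed
qed

end

section \<open>The equivariant map into the orders and its distribution\<close>

context free_pmp_action
begin

text \<open>The order is the \<open>key_order\<close> of the keys along the orbit. Two passages to
  invariant sets are made: to \<open>E\<close>, where it is linear with finite intervals, and to
  \<open>D\<close>, where it has no end points either.\<close>

lemma invariant_order:
  assumes folner: "folner_sequence G Fn" and inf: "infinite (carrier G)"
  obtains r :: "'x \<Rightarrow> 'g rel" and D where
    "D \<in> sets M" "prob D = 1" "D \<subseteq> X" "\<And>x g. x \<in> D \<Longrightarrow> g \<in> carrier G \<Longrightarrow> \<alpha> g x \<in> D"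
    "\<And>x. x \<in> D \<Longrightarrow> r x \<in> Z_orders G"
    "\<And>x g. x \<in> D \<Longrightarrow> g \<in> carrier G \<Longrightarrow> r (\<alpha> g x) = order_action G g (r x)"
    "\<And>a b. a \<in> carrier G \<Longrightarrow> b \<in> carrier G \<Longrightarrow> {x \<in> D. (a, b) \<in> r x} \<in> sets M"
proof -
  obtain m :: "nat \<Rightarrow> 'x \<Rightarrow> real" where m_meas: "\<And>n. m n \<in> borel_measurable M"
    and m_keys: "AE x in M. x \<in> X \<longrightarrow> coarsening_keys (carrier G) (\<lambda>n g. m n (\<alpha> g x))"
    by (rule invariant_keys[OF folner]) blast
  have AE_X: "AE x in M. x \<in> X"
    using prob_X X_sets by (simp add: prob_eq_1)
  have "AE x in M. x \<in> X \<and> coarsening_keys (carrier G) (\<lambda>n g. m n (\<alpha> g x))"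
    using AE_X m_keys by eventually_elim simp
  then obtain E where E: "E \<in> sets M" "prob E = 1"
    and E_X: "\<And>x. x \<in> E \<Longrightarrow> x \<in> X \<and> coarsening_keys (carrier G) (\<lambda>n g. m n (\<alpha> g x))"
    and E_act: "\<And>x g. x \<in> E \<Longrightarrow> g \<in> carrier G \<Longrightarrow> \<alpha> g x \<in> E"
    by (rule invariant_conull) blast
  define r where "r x = key_order (carrier G) (\<lambda>n g. m n (\<alpha> g x))" for x
  have r_sub: "r x \<subseteq> carrier G \<times> carrier G" for x by (auto simp: r_def key_order_def)
  have r_shift: "(a, b) \<in> r (\<alpha> g x) \<longleftrightarrow> (a \<otimes> g, b \<otimes> g) \<in> r x"
    if "x \<in> X" "g \<in> carrier G" "a \<in> carrier G" "b \<in> carrier G" for a b g x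
    using that by (simp add: r_def key_order_def act_mult)
  have r_total: "a = b \<or> (a, b) \<in> r x \<or> (b, a) \<in> r x"
    if "x \<in> E" "a \<in> carrier G" "b \<in> carrier G" for a b x
    using coarsening_keys.strict_linear_order_key_order[of "carrier G" "\<lambda>n g. m n (\<alpha> g x)"] E_X that
    by (auto simp: r_def strict_linear_order_on_def total_on_def)
  have r_sets: "{x \<in> A. (a, b) \<in> r x} \<in> sets M"
    if ab: "a \<in> carrier G" "b \<in> carrier G" and A: "A \<in> sets M" for a b A
  proof -
    have [measurable]: "(\<lambda>x. m n (\<alpha> g x)) \<in> borel_measurable M" if "g \<in> carrier G" for n g
      using measurable_compose[OF measurable_act[OF that] m_meas] .
    have "{x \<in> A. (a, b) \<in> r x} = A \<inter> {x \<in> space M. \<exists>n. m (Suc n) (\<alpha> a x) = m (Suc n) (\<alpha> b x) \<and>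
        m n (\<alpha> a x) < m n (\<alpha> b x)}"
      using ab sets.sets_into_space[OF A] by (auto simp: r_def key_order_def)
    also have "\<dots> \<in> sets M"
      using ab A by measurable
    finally show ?thesis .
  qed

  \<comment> \<open>The points that are the minimum, respectively maximum, of their orbit: an orbit contains at
    most one of each, so these sets have disjoint translates.\<close>
  define B1 where "B1 = {x \<in> E. \<forall>b\<in>carrier G. (b, \<one>) \<notin> r x}"
  define B2 where "B2 = {x \<in> E. \<forall>b\<in>carrier G. (\<one>, b) \<notin> r x}"
  have B_sets: "B1 \<in> sets M" "B2 \<in> sets M"
  proof -
    have "B1 = E - (\<Union>b\<in>carrier G. {x \<in> E. (b, \<one>) \<in> r x})"
      "B2 = E - (\<Union>b\<in>carrier G. {x \<in> E. (\<one>, b) \<in> r x})"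
      by (auto simp: B1_def B2_def)
    moreover have "(\<Union>b\<in>carrier G. {x \<in> E. (b, \<one>) \<in> r x}) \<in> sets M"
      "(\<Union>b\<in>carrier G. {x \<in> E. (\<one>, b) \<in> r x}) \<in> sets M"
      by (intro sets.countable_UN' countable_carrier image_subsetI r_sets one_closed E; assumption)+
    ultimately show "B1 \<in> sets M" "B2 \<in> sets M" using E by auto
  qed
  \<comment> \<open>Seen from \<open>\<alpha> g x\<close>, the point \<open>x\<close> has the
    coordinate \<open>inv g\<close>. If both points are minimal, or both maximal, neither precedes
    the other, and totality forces \<open>g = \<one>\<close>.\<close>
  have trans_one: "(inv g, \<one>) \<in> r (\<alpha> g x) \<longleftrightarrow> (\<one>, g) \<in> r x"
    "(\<one>, inv g) \<in> r (\<alpha> g x) \<longleftrightarrow> (g, \<one>) \<in> r x"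
    if "x \<in> E" "g \<in> carrier G" for g x
    using that E_X[OF that(1)] r_shift[of x g "inv g" \<one>] r_shift[of x g \<one> "inv g"] by auto
  have "prob B1 = 0"
  proof (rule null_if_disjoint_translates[OF inf B_sets(1)])
    show "B1 \<subseteq> X" using E_X by (auto simp: B1_def)
    show "g = \<one>" if "x \<in> B1" "g \<in> carrier G" "\<alpha> g x \<in> B1" for x g
      using that r_total[of x g \<one>] trans_one[of x g] by (auto simp: B1_def)
  qed
  moreover have "prob B2 = 0"
  proof (rule null_if_disjoint_translates[OF inf B_sets(2)])
    show "B2 \<subseteq> X" using E_X by (auto simp: B2_def)
    show "g = \<one>" if "x \<in> B2" "g \<in> carrier G" "\<alpha> g x \<in> B2" for x g
      using that r_total[of x g \<one>] trans_one[of x g] by (auto simp: B2_def)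
  qed
  ultimately have "AE x in M. x \<notin> B1" "AE x in M. x \<notin> B2"
    using B_sets by (auto intro!: AE_not_in null_setsI simp: emeasure_eq_measure)
  moreover have "AE x in M. x \<in> E"
    using E by (simp add: prob_eq_1)
  ultimately have "AE x in M. x \<in> E \<and> x \<notin> B1 \<and> x \<notin> B2"
    by eventually_elim simp
  \<comment> \<open>By invariance of \<open>D\<close> the whole orbit avoids \<open>B1\<close> and
    \<open>B2\<close>, so not only \<open>\<one>\<close> but no element of the group is an end point
    of \<open>r x\<close>.\<close>
  then obtain D where D: "D \<in> sets M" "prob D = 1"
    and D_E: "\<And>x. x \<in> D \<Longrightarrow> x \<in> E \<and> x \<notin> B1 \<and> x \<notin> B2"
    and D_act: "\<And>x g. x \<in> D \<Longrightarrow> g \<in> carrier G \<Longrightarrow> \<alpha> g x \<in> D"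
    by (rule invariant_conull) blast
  have r_Z: "r x \<in> Z_orders G" if x: "x \<in> D" for x
  proof -
    have xE: "x \<in> E" using D_E x by blast
    then have xX: "x \<in> X" and keys: "coarsening_keys (carrier G) (\<lambda>n g. m n (\<alpha> g x))"
      using E_X by auto
    have min: "\<exists>b\<in>carrier G. (b, a) \<in> r x" if a: "a \<in> carrier G" for a
    proof -
      obtain b where b: "b \<in> carrier G" "(b, \<one>) \<in> r (\<alpha> a x)"
        using D_E[OF D_act[OF x a]] by (auto simp: B1_def)
      then have "(b \<otimes> a, a) \<in> r x" using r_shift[OF xX a] a by auto
      then show ?thesis using r_sub by blast
    qed
    have max: "\<exists>b\<in>carrier G. (a, b) \<in> r x" if a: "a \<in> carrier G" for a
    proof -
      obtain b where b: "b \<in> carrier G" "(\<one>, b) \<in> r (\<alpha> a x)"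
        using D_E[OF D_act[OF x a]] by (auto simp: B2_def)
      then have "(a, b \<otimes> a) \<in> r x" using r_shift[OF xX a] a by auto
      then show ?thesis using r_sub by blast
    qed
    show ?thesis
      using r_sub[of x] min max coarsening_keys.strict_linear_order_key_order[OF keys]
        coarsening_keys.finite_key_order_interval[OF keys]
      unfolding Z_orders_def r_def by auto
  qed
  show thesis
  proof (rule that)
    show "D \<in> sets M" "prob D = 1" by (fact D)+
    show "D \<subseteq> X" using D_E E_X by blast
    show "\<alpha> g x \<in> D" if "x \<in> D" "g \<in> carrier G" for x g using that by (rule D_act)
    show "r x \<in> Z_orders G" if "x \<in> D" for x using that by (rule r_Z)
    show "r (\<alpha> g x) = order_action G g (r x)" if x: "x \<in> D" and g: "g \<in> carrier G" for x g
    proof -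
      have "x \<in> X" using x D_E E_X by blast
      then show ?thesis
        using r_Z[OF x] r_shift[OF _ g] r_sub[of "\<alpha> g x"] by (auto simp: order_action_def)
    qed
    show "{x \<in> D. (a, b) \<in> r x} \<in> sets M" if "a \<in> carrier G" "b \<in> carrier G" for a b
      using that D by (intro r_sets)
  qed
qed

text \<open>The measure \<open>\<nu>\<close> is the image under \<open>r\<close> of \<open>M\<close>
  restricted to \<open>D\<close>. Equivariance of \<open>r\<close> carries the invariance of
  \<open>M\<close> over to \<open>\<nu>\<close>.\<close>

lemma multiorder_factor:
  assumes folner: "folner_sequence G Fn" and inf: "infinite (carrier G)"
  shows "\<exists>(\<nu> :: 'g rel measure) (\<phi> :: 'x \<Rightarrow> 'g rel).
      multiorder G \<nu> \<and> factor_map G M \<alpha> \<nu> (order_action G) \<phi>"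
proof -
  obtain r :: "'x \<Rightarrow> 'g rel" and D where D: "D \<in> sets M" "prob D = 1" "D \<subseteq> X"
    and D_act: "\<And>x g. x \<in> D \<Longrightarrow> g \<in> carrier G \<Longrightarrow> \<alpha> g x \<in> D"
    and r_Z: "\<And>x. x \<in> D \<Longrightarrow> r x \<in> Z_orders G"
    and r_act: "\<And>x g. x \<in> D \<Longrightarrow> g \<in> carrier G \<Longrightarrow> r (\<alpha> g x) = order_action G g (r x)"
    and r_sets: "\<And>a b. a \<in> carrier G \<Longrightarrow> b \<in> carrier G \<Longrightarrow> {x \<in> D. (a, b) \<in> r x} \<in> sets M"
    by (rule invariant_order[OF folner inf]) blast
  define N where "N = restrict_space M D"
  define Z where "Z = Z_orders_algebra G"
  define \<nu> where "\<nu> = distr N Z r"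
  have D_space: "D \<subseteq> space M" using D sets.sets_into_space by blast
  have space_N: "space N = D" using D_space by (auto simp: N_def space_restrict_space)
  have sets_N: "A \<in> sets N \<longleftrightarrow> A \<in> sets M \<and> A \<subseteq> D" for A
    using D D_space unfolding N_def by (subst sets_restrict_space_iff) (auto simp: Int_absorb2)
  have emeasure_N: "emeasure N A = emeasure M A" if "A \<subseteq> D" for A
    using D D_space that unfolding N_def by (subst emeasure_restrict_space) (auto simp: Int_absorb2)
  have r_meas: "r \<in> measurable N Z"
    unfolding Z_def
  proof (rule measurable_Z_orders[OF countable_carrier])
    show "r x \<in> Z_orders G" if "x \<in> space N" for x using that r_Z by (simp add: space_N)
    show "{x \<in> space N. (a, b) \<in> r x} \<in> sets N" if "a \<in> carrier G" "b \<in> carrier G" for a b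
      using r_sets[OF that] by (auto simp: space_N sets_N)
  qed
  have beta_meas: "order_action G g \<in> measurable Z Z" if "g \<in> carrier G" for g
    unfolding Z_def using countable_carrier that by (rule order_action_measurable)
  \<comment> \<open>Applying \<open>inv g\<close> shows that points of \<open>X\<close> sent into
    \<open>D\<close> already lie in \<open>D\<close>, so measures of preimages can be computed in
    \<open>X\<close>.\<close>
  have pre: "\<alpha> g -` A \<inter> space N = {x \<in> X. \<alpha> g x \<in> A}" if g: "g \<in> carrier G" and A: "A \<subseteq> D" for g A
  proof -
    have "x \<in> D" if x: "x \<in> X" "\<alpha> g x \<in> A" for x
    proof -
      have "\<alpha> (inv g) (\<alpha> g x) \<in> D" using x A g D_act by blast
      then show ?thesis using x g by (simp add: act_inv)
    qed
    then show ?thesis using D(3) by (auto simp: space_N)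
  qed
  have act_N: "\<alpha> g \<in> measurable N N" if g: "g \<in> carrier G" for g
  proof (rule measurableI)
    show "\<alpha> g x \<in> space N" if "x \<in> space N" for x using that g D_act by (simp add: space_N)
    show "\<alpha> g -` A \<inter> space N \<in> sets N" if "A \<in> sets N" for A
      using that pre[OF g, of A] sets_act[OF g, of A] by (auto simp: sets_N space_N)
  qed
  have distr_N: "distr N N (\<alpha> g) = N" if g: "g \<in> carrier G" for g
  proof (rule measure_eqI)
    fix A assume "A \<in> sets (distr N N (\<alpha> g))"
    then have A: "A \<in> sets N" "A \<in> sets M" "A \<subseteq> D" by (auto simp: sets_N)
    have "emeasure (distr N N (\<alpha> g)) A = emeasure N (\<alpha> g -` A \<inter> space N)"
      using act_N[OF g] A(1) by (rule emeasure_distr)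
    also have "\<dots> = emeasure M (\<alpha> g -` A \<inter> space N)"
      by (rule emeasure_N) (auto simp: space_N)
    also have "\<dots> = emeasure M A"
      using pre[OF g A(3)] emeasure_act[OF g A(2)] by simp
    finally show "emeasure (distr N N (\<alpha> g)) A = emeasure N A"
      using A(3) by (simp add: emeasure_N)
  qed simp
  have sets_\<nu>: "sets \<nu> = sets Z" by (simp add: \<nu>_def)
  have space_\<nu>: "space \<nu> = Z_orders G" by (simp add: \<nu>_def Z_def space_Z_orders_algebra)
  have emeasure_D: "emeasure M D = 1" using D by (simp add: emeasure_eq_measure)
  have "prob_space N"
    by (rule prob_spaceI) (simp add: space_N emeasure_N emeasure_D)
  then have prob_\<nu>: "prob_space \<nu>"
    unfolding \<nu>_def using r_meas by (rule prob_space.prob_space_distr)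
  have "distr \<nu> \<nu> (order_action G g) = \<nu>" if g: "g \<in> carrier G" for g
  proof -
    have "distr \<nu> \<nu> (order_action G g) = distr (distr N Z r) Z (order_action G g)"
      unfolding \<nu>_def by (rule distr_cong) auto
    also have "\<dots> = distr N Z (order_action G g \<circ> r)"
      using beta_meas[OF g] r_meas by (rule distr_distr)
    also have "\<dots> = distr N Z (r \<circ> \<alpha> g)"
      using r_act g by (intro distr_cong) (auto simp: space_N)
    also have "\<dots> = distr (distr N N (\<alpha> g)) Z r"
      using r_meas act_N[OF g] by (rule distr_distr[symmetric])
    also have "\<dots> = \<nu>" using distr_N[OF g] by (simp add: \<nu>_def)
    finally show ?thesis .
  qed
  moreover have "order_action G g \<in> measurable \<nu> \<nu>" if "g \<in> carrier G" for g
    using beta_meas[OF that] measurable_cong_sets[OF sets_\<nu> sets_\<nu>] by simp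
  ultimately have "multiorder G \<nu>"
    using prob_\<nu> group_action_order_action sets_\<nu>
    by (simp add: multiorder_def measure_preserving_action_def space_\<nu> Z_def)
  moreover have "factor_map G M \<alpha> \<nu> (order_action G) r"
    unfolding factor_map_def
  proof (intro bexI[of _ D] conjI)
    show "emeasure M D = 1" "D \<in> sets M" by fact+
    show "r \<in> measurable (restrict_space M D) \<nu>"
      using r_meas measurable_cong_sets[OF refl sets_\<nu>] unfolding N_def by blast
    have "distr N \<nu> r = \<nu>"
      unfolding \<nu>_def by (rule distr_cong) auto
    then show "distr (restrict_space M D) \<nu> r = \<nu>" by (simp add: N_def)
    have "AE x in M. x \<in> D" using D by (simp add: prob_eq_1)
    then show "AE x in M. \<forall>g\<in>carrier G. x \<in> D \<and> \<alpha> g x \<in> D \<and> r (\<alpha> g x) = order_action G g (r x)"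
      by eventually_elim (use D_act r_act in auto)
  qed
  ultimately show ?thesis by blast
qed

end

section \<open>Standard spaces and assembly of the proof\<close>

lemma standard_prob_space_embedding:
  fixes M :: "'x measure"
  assumes "standard_prob_space M"
  obtains h :: "'x \<Rightarrow> real" and Y where
    "h \<in> borel_measurable M" "inj_on h Y" "AE x in M. x \<in> Y"
proof -
  obtain T where pM: "prob_space M" and cm: "completely_metrizable_space T" and sc: "second_countable T"
    and T: "topspace T \<in> sets M" "emeasure M (topspace T) = 1" and T_sets: "sets (borel_of T) \<subseteq> sets M"
    using assms unfolding standard_prob_space_def by blast
  have Hd: "Hausdorff_space T"
    using cm completely_metrizable_imp_metrizable_space metrizable_imp_Hausdorff_space by blast
  obtain \<B> where B: "countable \<B>" "\<forall>V\<in>\<B>. openin T V"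
    and basis: "\<forall>U x. openin T U \<and> x \<in> U \<longrightarrow> (\<exists>V\<in>\<B>. x \<in> V \<and> V \<subseteq> U)"
    using sc unfolding second_countable_def by (elim exE conjE)
  \<comment> \<open>Adding the empty set makes the family nonempty, as the enumeration
    requires.\<close>
  define U where "U = from_nat_into (insert {} \<B>)"
  have U_range: "range U = insert {} \<B>"
    unfolding U_def using B(1) by (intro range_from_nat_into) auto
  have open_sets: "V \<in> sets M" if "openin T V" for V
  proof -
    have "V \<in> sets (borel_of T)"
      using that unfolding borel_of_def by (subst sets_measure_of) (auto dest: openin_subset)
    then show ?thesis using T_sets by blast
  qed
  have U_sets: "U k \<in> sets M" for k
  proof -
    have "U k \<in> insert {} \<B>" using U_range by blast
    then show ?thesis using open_sets B(2) by auto
  qed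
  have sep: "\<exists>k. (x \<in> U k) \<noteq> (y \<in> U k)" if xy: "x \<in> topspace T" "y \<in> topspace T" "x \<noteq> y" for x y
  proof -
    obtain V W where VW: "openin T V" "openin T W" "x \<in> V" "y \<in> W" "disjnt V W"
      using Hd xy unfolding Hausdorff_space_def by blast
    then obtain V' where V': "V' \<in> \<B>" "x \<in> V'" "V' \<subseteq> V" using basis by meson
    have "V' \<in> range U" using V' U_range by blast
    then obtain k where "U k = V'" by blast
    then show ?thesis using V' VW by (auto simp: disjnt_def)
  qed
  obtain h :: "'x \<Rightarrow> real" where "h \<in> borel_measurable M" "inj_on h (topspace T)"
    by (rule separating_real_function[of U M "topspace T"]) (use U_sets sep in blast)+
  moreover have "AE x in M. x \<in> topspace T"
    using prob_space.prob_eq_1[OF pM T(1)] T(2) by (simp add: measure_def)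
  ultimately show thesis by (rule that)
qed

theorem corollary3p3:
  fixes G :: "('g, 'b) monoid_scheme"
    and M :: "'x measure"
    and \<alpha> :: "'g \<Rightarrow> 'x \<Rightarrow> 'x"
  assumes "countable_amenable_group G"
    and "standard_prob_space M"
    and "measure_preserving_action G M \<alpha>"
    and "free_action G M \<alpha>"
  shows "\<exists>(\<nu> :: 'g rel measure) (\<phi> :: 'x \<Rightarrow> 'g rel).
           multiorder G \<nu> \<and> factor_map G M \<alpha> \<nu> (order_action G) \<phi>"
proof -
  obtain Fn where G: "countable (carrier G)" "infinite (carrier G)" and folner: "folner_sequence G Fn"
    using assms(1) unfolding countable_amenable_group_def by blast
  have act: "prob_space M" "group_action G (space M) \<alpha>"
    "\<And>g. g \<in> carrier G \<Longrightarrow> \<alpha> g \<in> measurable M M" "\<And>g. g \<in> carrier G \<Longrightarrow> distr M M (\<alpha> g) = M"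
    using assms(3) unfolding measure_preserving_action_def by auto
  interpret P: pmp_action M G \<alpha>
    by (intro pmp_action.intro pmp_action_axioms.intro act G(1))
  obtain h :: "'x \<Rightarrow> real" and Y where h: "h \<in> borel_measurable M" "inj_on h Y" "AE x in M. x \<in> Y"
    by (rule standard_prob_space_embedding[OF assms(2)])
  have "AE x in M. x \<in> Y \<and> stabilizer G \<alpha> x = {\<one>\<^bsub>G\<^esub>}"
    using h(3) assms(4) unfolding free_action_def by eventually_elim simp
  \<comment> \<open>On this invariant set freeness and injectivity of \<open>h\<close> hold at every
    point.\<close>
  then obtain X where X: "X \<in> sets M" "P.prob X = 1"
    "\<And>x. x \<in> X \<Longrightarrow> x \<in> Y \<and> stabilizer G \<alpha> x = {\<one>\<^bsub>G\<^esub>}"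
    "\<And>x g. x \<in> X \<Longrightarrow> g \<in> carrier G \<Longrightarrow> \<alpha> g x \<in> X"
    by (rule P.invariant_conull) blast
  interpret free_pmp_action M G \<alpha> X h
  proof
    show "g = \<one>\<^bsub>G\<^esub>" if "x \<in> X" "g \<in> carrier G" "\<alpha> g x = x" for x g
      using X(3)[OF that(1)] that by (auto simp: stabilizer_def)
    show "inj_on h X"
      using h(2) by (rule inj_on_subset) (use X(3) in blast)
  qed (fact X h)+
  show ?thesis using folner G(2) by (rule multiorder_factor)
qed

end
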